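(* Let $\mathcal M=(M,\rho)$ be a six-point metric space, $M=\{p_1,\dots,p_6\}$, $d_{ij}=\rho(p_i,p_j)$. Let $G$ be the binary tree with boundary $M$ having three moustaches $\{p_1,p_2\}$, $\{p_3,p_4\}$ and $\{p_5,p_6\}$. Then the polyhedral set $\Lambda_G$ is a $6$-dimensional convex polyhedron in $\mathbb R^{15}$ with exactly $12$ vertices, namely (coordinates $\lambda_{ij}$, $i<j$, ordered lexicographically) $$\tfrac12(1,0,0,0,1,0,1,0,0,1,1,0,0,0,1),\quad \tfrac12(1,0,1,0,0,0,0,0,1,1,1,0,0,0,1),$$ $$\tfrac12(1,0,0,1,0,0,1,0,0,1,0,1,0,0,1),\quad \tfrac12(1,0,1,0,0,0,0,1,0,1,0,1,0,0,1),$$ $$\tfrac14(2,1,0,0,1,0,1,1,0,2,0,1,1,0,2),\quad \tfrac14(2,0,1,1,0,1,0,0,1,2,0,1,1,0,2),$$ $$\tfrac12(1,0,0,0,1,1,0,0,0,1,0,0,1,0,1),\quad \tfrac12(1,1,0,0,0,0,0,0,1,1,0,0,1,0,1),$$ $$\tfrac14(2,0,1,0,1,1,0,1,0,2,1,0,0,1,2),\quad \tfrac14(2,1,0,1,0,0,1,0,1,2,1,0,0,1,2),$$ $$\tfrac12(1,0,0,1,0,1,0,0,0,1,0,0,0,1,1),\quad \tfrac12(1,1,0,0,0,0,0,1,0,1,0,0,0,1,1),$$ and the weight $\mathrm{mpf}_{-}(\mathcal M,G)$ of the generalized minimal parametric filling of type $G$ of $\mathcal M$ is equal to the maximum of the twelve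 values $$\tfrac12(d_{12}+d_{16}+d_{24}+d_{34}+d_{35}+d_{56}),\quad \tfrac12(d_{12}+d_{14}+d_{26}+d_{34}+d_{35}+d_{56}),$$ $$\tfrac12(d_{12}+d_{15}+d_{24}+d_{34}+d_{36}+d_{56}),\quad \tfrac12(d_{12}+d_{14}+d_{25}+d_{34}+d_{36}+d_{56}),$$ $$\tfrac14(2d_{12}+d_{13}+d_{16}+d_{24}+d_{25}+2d_{34}+d_{36}+d_{45}+2d_{56}),$$ $$\tfrac14(2d_{12}+d_{14}+d_{15}+d_{23}+d_{26}+2d_{34}+d_{36}+d_{45}+2d_{56}),$$ $$\tfrac12(d_{12}+d_{16}+d_{23}+d_{34}+d_{45}+d_{56}),\quad \tfrac12(d_{12}+d_{13}+d_{26}+d_{34}+d_{45}+d_{56}),$$ $$\tfrac14(2d_{12}+d_{14}+d_{16}+d_{23}+d_{25}+2d_{34}+d_{35}+d_{46}+2d_{56}),$$ $$\tfrac14(2d_{12}+d_{13}+d_{15}+d_{24}+d_{26}+2d_{34}+d_{35}+d_{46}+2d_{56}),$$ $$\tfrac12(d_{12}+d_{15}+d_{23}+d_{34}+d_{46}+d_{56}),\quad \tfrac12(d_{12}+d_{13}+d_{25}+d_{34}+d_{46}+d_{56}).$$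
   Context: A binary tree is a finite tree all of whose vertices have degree $1$ or $3$; its boundary is the set of all its vertices of degree $1$. Moustaches of a binary tree are a pair of boundary vertices having a common neighbouring vertex. Let $G=(V,E)$ be a binary tree with boundary $M=\{p_1,\dots,p_n\}$. For $i<j$ let $\gamma(i,j)$ denote the unique path in $G$ joining $p_i$ and $p_j$. A function $\omega\colon E\to\mathbb R$ (negative values allowed) makes $G$ a generalized filling of $\mathcal M$ if $\sum_{e\in\gamma(i,j)}\omega(e)\ge d_{ij}$ for all $1\le i<j\le n$. Then $\mathrm{mpf}_{-}(\mathcal M,G)$ is the infimum of $\sum_{e\in E}\omega(e)$ over all such $\omega$. Each edge $e\in E$ generates a partition $\mathcal P_G(e)=\{M_1,M_2\}$ of $M$, where $M_1,M_2$ are the sets of elements of $M$ lying in the two connected components obtained by deleting $e$ from $G$. The set $\Lambda_G\subset\mathbb R^{n(n-1)/2}$ consists of all vectors $\lambda=(\lambda_{ij})_{1\le i<j\le n}$ with $\lambda_{ij}\ge0$ and, for every $e\in E$, $\sum\lambda_{ij}=1$, where the sum is over all $i<j$ such that $p_i$ and $p_j$ lie in different elements of $\mathcal P_G(e)$. *)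

theory Defs
  imports "HOL-Analysis.Analysis"
begin

section \<open>Finite simple graphs and binary trees\<close>

definition simple_graph :: "'a set \<Rightarrow> 'a set set \<Rightarrow> bool" where
  "simple_graph V E \<longleftrightarrow> finite V \<and> E \<subseteq> {e. e \<subseteq> V \<and> card e = 2}"

definition graph_path :: "'a set \<Rightarrow> 'a set set \<Rightarrow> 'a list \<Rightarrow> bool" where
  "graph_path V E xs \<longleftrightarrow> xs \<noteq> [] \<and> set xs \<subseteq> V \<and> distinct xs \<and>
     (\<forall>k. Suc k < length xs \<longrightarrow> {xs ! k, xs ! Suc k} \<in> E)"

definition path_joining :: "'a set \<Rightarrow> 'a set set \<Rightarrow> 'a \<Rightarrow> 'a \<Rightarrow> 'a list \<Rightarrow> bool" where
  "path_joining V E u v xs \<longleftrightarrow> graph_path V E xs \<and> hd xs = u \<and> last xs = v"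

definition path_edges :: "'a list \<Rightarrow> 'a set set" where
  "path_edges xs = {{xs ! k, xs ! Suc k} | k. Suc k < length xs}"

definition joined :: "'a set \<Rightarrow> 'a set set \<Rightarrow> 'a \<Rightarrow> 'a \<Rightarrow> bool" where
  "joined V E u v \<longleftrightarrow> (\<exists>xs. path_joining V E u v xs)"

definition components_of_graph :: "'a set \<Rightarrow> 'a set set \<Rightarrow> 'a set set" where
  "components_of_graph V E = {{v \<in> V. joined V E u v} | u. u \<in> V}"

definition graph_cycle :: "'a set \<Rightarrow> 'a set set \<Rightarrow> 'a list \<Rightarrow> bool" where
  "graph_cycle V E xs \<longleftrightarrow> graph_path V E xs \<and> 3 \<le> length xs \<and> {last xs, hd xs} \<in> E"

definition tree_graph :: "'a set \<Rightarrow> 'a set set \<Rightarrow> bool" where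
  "tree_graph V E \<longleftrightarrow> simple_graph V E \<and> V \<noteq> {} \<and>
     (\<forall>u\<in>V. \<forall>v\<in>V. joined V E u v) \<and> (\<nexists>xs. graph_cycle V E xs)"

definition vertex_degree :: "'a set set \<Rightarrow> 'a \<Rightarrow> nat" where
  "vertex_degree E v = card {e \<in> E. v \<in> e}"

definition binary_tree :: "'a set \<Rightarrow> 'a set set \<Rightarrow> bool" where
  "binary_tree V E \<longleftrightarrow> tree_graph V E \<and> (\<forall>v\<in>V. vertex_degree E v \<in> {1, 3})"

definition boundary :: "'a set \<Rightarrow> 'a set set \<Rightarrow> 'a set" where
  "boundary V E = {v \<in> V. vertex_degree E v = 1}"

definition moustaches :: "'a set \<Rightarrow> 'a set set \<Rightarrow> 'a set set" where
  "moustaches V E = {{u, v} | u v. u \<in> boundary V E \<and> v \<in> boundary V E \<and> u \<noteq> v \<and>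
     (\<exists>w. {u, w} \<in> E \<and> {v, w} \<in> E)}"

section \<open>Generalized fillings\<close>

text \<open>In a tree the joining path exists and is unique, so the description is proper.\<close>

definition tree_path :: "'a set \<Rightarrow> 'a set set \<Rightarrow> 'a \<Rightarrow> 'a \<Rightarrow> 'a set set" where
  "tree_path V E u v = path_edges (THE xs. path_joining V E u v xs)"

definition generalized_filling ::
  "'a set \<Rightarrow> 'a set set \<Rightarrow> (nat \<Rightarrow> 'a) \<Rightarrow> nat \<Rightarrow> ('a \<Rightarrow> 'a \<Rightarrow> real) \<Rightarrow> ('a set \<Rightarrow> real) \<Rightarrow> bool" where
  "generalized_filling V E p n \<rho> \<omega> \<longleftrightarrow>
     (\<forall>i j. 1 \<le> i \<and> i < j \<and> j \<le> n \<longrightarrow>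
        (\<Sum>e \<in> tree_path V E (p i) (p j). \<omega> e) \<ge> \<rho> (p i) (p j))"

text \<open>The infimum is taken in the extended reals, where no set of weights is exceptional: a finite
  value entails that fillings exist and that their total weights are bounded below.\<close>

definition mpf_minus ::
  "'a set \<Rightarrow> 'a set set \<Rightarrow> (nat \<Rightarrow> 'a) \<Rightarrow> nat \<Rightarrow> ('a \<Rightarrow> 'a \<Rightarrow> real) \<Rightarrow> ereal" where
  "mpf_minus V E p n \<rho> = (INF \<omega> \<in> {\<omega>. generalized_filling V E p n \<rho> \<omega>}. ereal (\<Sum>e\<in>E. \<omega> e))"

section \<open>The polyhedral set of a binary tree\<close>

definition edge_partition :: "'a set \<Rightarrow> 'a set set \<Rightarrow> 'a set \<Rightarrow> 'a set set" where
  "edge_partition V E e = (\<lambda>C. boundary V E \<inter> C) ` components_of_graph V (E - {e})"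

definition separated_by :: "'a set \<Rightarrow> 'a set set \<Rightarrow> 'a set \<Rightarrow> 'a \<Rightarrow> 'a \<Rightarrow> bool" where
  "separated_by V E e u v \<longleftrightarrow>
     (\<exists>A \<in> edge_partition V E e. \<exists>B \<in> edge_partition V E e. A \<noteq> B \<and> u \<in> A \<and> v \<in> B)"

text \<open>The place, counted from 1, of \<open>(i, j)\<close> in the lexicographic list of all pairs
  \<open>1 \<le> i < j \<le> n\<close>.\<close>

definition lex_pos :: "nat \<Rightarrow> nat \<Rightarrow> nat \<Rightarrow> nat" where
  "lex_pos n i j = card {(a, b). 1 \<le> a \<and> a < b \<and> b \<le> n \<and> (a < i \<or> a = i \<and> b \<le> j)}"

text \<open>The index type \<open>'k\<close> is meant to be the numeral type with \<open>n (n - 1) / 2\<close> elements. Its elements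
  are then \<open>1, 2, \<dots>, n (n - 1) / 2\<close> (the last being equal to \<open>0\<close>), which is also the numbering
  of components used by \<^const>\<open>vector\<close>.\<close>

definition pair_coord :: "nat \<Rightarrow> real ^ 'k::{finite, comm_ring_1} \<Rightarrow> nat \<Rightarrow> nat \<Rightarrow> real" where
  "pair_coord n x i j = x $ of_nat (lex_pos n i j)"

definition Lambda ::
  "'a set \<Rightarrow> 'a set set \<Rightarrow> (nat \<Rightarrow> 'a) \<Rightarrow> nat \<Rightarrow> (real ^ 'k::{finite, comm_ring_1}) set" where
  "Lambda V E p n =
     {x. (\<forall>i j. 1 \<le> i \<and> i < j \<and> j \<le> n \<longrightarrow> 0 \<le> pair_coord n x i j) \<and>
         (\<forall>e\<in>E. (\<Sum>(i, j) \<in> {(i, j). 1 \<le> i \<and> i < j \<and> j \<le> n \<and> separated_by V E e (p i) (p j)}.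
            pair_coord n x i j) = 1)}"

end

theory Submission
  imports Defs
begin

text \<open>
A binary tree with six leaves has four inner vertices (count the edges once as a forest and once
by degrees), so three moustaches force the shape of the locale \<open>tripod\<close>: three hubs \<open>a, b, c\<close>,
each carrying two leaves, around a centre \<open>z\<close>. Subtracting the equation of an inner edge from
those of its two leaf edges gives \<open>\<lambda>\<^sub>1\<^sub>2 = \<lambda>\<^sub>3\<^sub>4 = \<lambda>\<^sub>5\<^sub>6 = 1/2\<close>. What remains says
that the twelve other coordinates, placed on the edges of the octahedron \<open>K(2,2,2)\<close> (join leaves
of different moustaches), sum to \<open>1/2\<close> at every vertex: \<open>\<Lambda>\<close> is the polytope of fractional
perfect matchings of the octahedron, scaled by \<open>1/2\<close>. Its vertices are the eight perfect matchings
and the four half-integral points supported on two opposite triangles.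

The two kinds have a common description. Write \<open>P, Q, R\<close> for the moustaches and read an edge \<open>uv\<close>
with \<open>u\<close> in one of them and \<open>v\<close> in the next (cyclically) as an arc from \<open>u\<close> to the mate of \<open>v\<close>,
that is, to the other leaf of the moustache of \<open>v\<close>. The matching equations make the coordinates a
circulation on this digraph, and its simple closed walks have length 3 (the perfect matchings)
or 6 (the pairs of triangles). Consequently, if a weight on the octahedron is at most \<open>m\<close> on
the twelve special points, no closed walk has positive reduced weight, and longest walks give a
potential. Undoing the twist, the potential is an assignment \<open>u\<close> to the leaves with
\<open>u\<^sub>i + u\<^sub>j \<ge> d\<^sub>i\<^sub>j\<close> whose total attains the bound (\<open>tripod_potential\<close>, \<open>dual_solution\<close>).

This explicit dual solution does both halves of the work. Summed against a point of \<open>\<Lambda>\<close>, it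
shows that no linear functional is larger on \<open>\<Lambda>\<close> than on the twelve points, so \<open>\<Lambda>\<close> is their
convex hull by separation (\<open>tripod_polytope_eq_hull\<close>). Read as edge weights, it is a generalized
filling of weight \<open>max\<close>; that no filling is lighter is weak duality (\<open>mpf_minus_tripod\<close>). Each of
the twelve points is extreme because it is determined by its support, and the dimension is 6
because six of the coordinates parametrise the solutions of the equations near a positive one.
\<close>

section \<open>Components of vectors and pairs of indices\<close>

lemma exhaust_15:
  fixes k :: 15
  shows "k = 1 \<or> k = 2 \<or> k = 3 \<or> k = 4 \<or> k = 5 \<or> k = 6 \<or> k = 7 \<or> k = 8 \<or> k = 9 \<or> k = 10 \<or>
    k = 11 \<or> k = 12 \<or> k = 13 \<or> k = 14 \<or> k = 15"
proof (induct k)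
  case (of_int z)
  then have "0 \<le> z" and "z < 15" by simp_all
  then have "z = 0 \<or> z = 1 \<or> z = 2 \<or> z = 3 \<or> z = 4 \<or> z = 5 \<or> z = 6 \<or> z = 7 \<or> z = 8 \<or> z = 9 \<or>
    z = 10 \<or> z = 11 \<or> z = 12 \<or> z = 13 \<or> z = 14" by arith
  then show ?case by (elim disjE; simp)
qed

lemma forall_15: "(\<forall>k::15. P k) \<longleftrightarrow> P 1 \<and> P 2 \<and> P 3 \<and> P 4 \<and> P 5 \<and> P 6 \<and> P 7 \<and> P 8 \<and> P 9 \<and> P 10 \<and>
    P 11 \<and> P 12 \<and> P 13 \<and> P 14 \<and> P 15"
  using exhaust_15 by metis

lemma UNIV_15: "UNIV = {1, 2, 3, 4, 5, 6, 7, 8, 9, 10, 11, 12, 13, 14, 15::15}"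
  using exhaust_15 by auto

lemma sum_15: "sum f (UNIV :: 15 set) = f 1 + f 2 + f 3 + f 4 + f 5 + f 6 + f 7 + f 8 + f 9 + f 10 +
    f 11 + f 12 + f 13 + f 14 + f 15"
  unfolding UNIV_15 by (simp add: ac_simps)

lemma exhaust_6:
  fixes k :: 6
  shows "k = 1 \<or> k = 2 \<or> k = 3 \<or> k = 4 \<or> k = 5 \<or> k = 6"
proof (induct k)
  case (of_int z)
  then have "0 \<le> z" and "z < 6" by simp_all
  then have "z = 0 \<or> z = 1 \<or> z = 2 \<or> z = 3 \<or> z = 4 \<or> z = 5" by arith
  then show ?case by (elim disjE; simp)
qed

text \<open>Stated for a named vector, so that it also serves for vectors that should stay folded.\<close>

lemma vector_15:
  fixes v :: "('a::zero)^15"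
  assumes "v = vector [x1, x2, x3, x4, x5, x6, x7, x8, x9, x10, x11, x12, x13, x14, x15]"
  shows "v $ 1 = x1" "v $ 2 = x2" "v $ 3 = x3" "v $ 4 = x4" "v $ 5 = x5" "v $ 6 = x6" "v $ 7 = x7"
    "v $ 8 = x8" "v $ 9 = x9" "v $ 10 = x10" "v $ 11 = x11" "v $ 12 = x12" "v $ 13 = x13"
    "v $ 14 = x14" "v $ 15 = x15"
  unfolding assms vector_def by simp_all

lemmas vector_15_nth [simp] = vector_15[OF refl]

lemma pairs_upto_6:
  "{(i, j). 1 \<le> i \<and> i < j \<and> j \<le> (6::nat)} =
    {(1, 2), (1, 3), (1, 4), (1, 5), (1, 6), (2, 3), (2, 4), (2, 5), (2, 6),
     (3, 4), (3, 5), (3, 6), (4, 5), (4, 6), (5, 6)}"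
proof (intro set_eqI, clarify)
  fix i j :: nat
  have "1 \<le> i \<and> i < j \<and> j \<le> 6 \<longleftrightarrow> i = 1 \<and> j = 2 \<or> i = 1 \<and> j = 3 \<or> i = 1 \<and> j = 4 \<or>
    i = 1 \<and> j = 5 \<or> i = 1 \<and> j = 6 \<or> i = 2 \<and> j = 3 \<or> i = 2 \<and> j = 4 \<or> i = 2 \<and> j = 5 \<or>
    i = 2 \<and> j = 6 \<or> i = 3 \<and> j = 4 \<or> i = 3 \<and> j = 5 \<or> i = 3 \<and> j = 6 \<or> i = 4 \<and> j = 5 \<or>
    i = 4 \<and> j = 6 \<or> i = 5 \<and> j = 6" by presburger
  then show "(i, j) \<in> {(i, j). 1 \<le> i \<and> i < j \<and> j \<le> 6} \<longleftrightarrow>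
    (i, j) \<in> {(1, 2), (1, 3), (1, 4), (1, 5), (1, 6), (2, 3), (2, 4), (2, 5), (2, 6),
      (3, 4), (3, 5), (3, 6), (4, 5), (4, 6), (5, 6)}" by simp
qed

lemma all_pairs_upto_6:
  "(\<forall>i j. 1 \<le> i \<and> i < j \<and> j \<le> (6::nat) \<longrightarrow> P i j) \<longleftrightarrow>
    P 1 2 \<and> P 1 3 \<and> P 1 4 \<and> P 1 5 \<and> P 1 6 \<and> P 2 3 \<and> P 2 4 \<and> P 2 5 \<and> P 2 6 \<and>
    P 3 4 \<and> P 3 5 \<and> P 3 6 \<and> P 4 5 \<and> P 4 6 \<and> P 5 6"
proof -
  have "(\<forall>i j. 1 \<le> i \<and> i < j \<and> j \<le> (6::nat) \<longrightarrow> P i j) \<longleftrightarrow>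
    (\<forall>(i, j)\<in>{(i, j). 1 \<le> i \<and> i < j \<and> j \<le> (6::nat)}. P i j)" by auto
  then show ?thesis unfolding pairs_upto_6 by simp
qed

lemma sum_pairs_upto_6:
  fixes f :: "nat \<Rightarrow> nat \<Rightarrow> 'b::comm_monoid_add"
  shows "(\<Sum>(i, j)\<in>{(i, j). 1 \<le> i \<and> i < j \<and> j \<le> 6 \<and> Q i j}. f i j) =
    (if Q 1 2 then f 1 2 else 0) + (if Q 1 3 then f 1 3 else 0) + (if Q 1 4 then f 1 4 else 0) +
    (if Q 1 5 then f 1 5 else 0) + (if Q 1 6 then f 1 6 else 0) + (if Q 2 3 then f 2 3 else 0) +
    (if Q 2 4 then f 2 4 else 0) + (if Q 2 5 then f 2 5 else 0) + (if Q 2 6 then f 2 6 else 0) +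
    (if Q 3 4 then f 3 4 else 0) + (if Q 3 5 then f 3 5 else 0) + (if Q 3 6 then f 3 6 else 0) +
    (if Q 4 5 then f 4 5 else 0) + (if Q 4 6 then f 4 6 else 0) + (if Q 5 6 then f 5 6 else 0)"
proof -
  let ?P = "{(i, j). 1 \<le> i \<and> i < j \<and> j \<le> (6::nat)}"
  have "{(i, j). 1 \<le> i \<and> i < j \<and> j \<le> 6 \<and> Q i j} = {x \<in> ?P. case x of (i, j) \<Rightarrow> Q i j}" by auto
  then have "(\<Sum>(i, j)\<in>{(i, j). 1 \<le> i \<and> i < j \<and> j \<le> 6 \<and> Q i j}. f i j) =
      (\<Sum>x\<in>?P. if case x of (i, j) \<Rightarrow> Q i j then case x of (i, j) \<Rightarrow> f i j else 0)"
    by (simp only:) (rule sum.inter_filter, simp only: pairs_upto_6, simp)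
  then show ?thesis unfolding pairs_upto_6 by (simp add: add.assoc split del: if_split cong: if_cong)
qed

text \<open>Counting the predecessors of a pair is itself a sum of ones over pairs of indices.\<close>

lemma lex_pos_6:
  "lex_pos 6 1 2 = 1" "lex_pos 6 1 3 = 2" "lex_pos 6 1 4 = 3" "lex_pos 6 1 5 = 4" "lex_pos 6 1 6 = 5"
  "lex_pos 6 2 3 = 6" "lex_pos 6 2 4 = 7" "lex_pos 6 2 5 = 8" "lex_pos 6 2 6 = 9" "lex_pos 6 3 4 = 10"
  "lex_pos 6 3 5 = 11" "lex_pos 6 3 6 = 12" "lex_pos 6 4 5 = 13" "lex_pos 6 4 6 = 14" "lex_pos 6 5 6 = 15"
proof -
  have "lex_pos 6 i j =
    (\<Sum>(a, b)\<in>{(a, b). 1 \<le> a \<and> a < b \<and> b \<le> 6 \<and> (a < i \<or> a = i \<and> b \<le> j)}. 1)" for i j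
    by (simp add: lex_pos_def case_prod_unfold)
  note lex = this[unfolded sum_pairs_upto_6]
  show "lex_pos 6 1 2 = 1" "lex_pos 6 1 3 = 2" "lex_pos 6 1 4 = 3" "lex_pos 6 1 5 = 4" "lex_pos 6 1 6 = 5"
    "lex_pos 6 2 3 = 6" "lex_pos 6 2 4 = 7" "lex_pos 6 2 5 = 8" "lex_pos 6 2 6 = 9" "lex_pos 6 3 4 = 10"
    "lex_pos 6 3 5 = 11" "lex_pos 6 3 6 = 12" "lex_pos 6 4 5 = 13" "lex_pos 6 4 6 = 14" "lex_pos 6 5 6 = 15"
    unfolding lex by simp_all
qed

section \<open>Potentials on the layered digraph\<close>

lemma forall_bool: "(\<forall>b. P b) \<longleftrightarrow> P True \<and> P False"
  by (metis (full_types))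

lemma ex_bool: "(\<exists>b. P b) \<longleftrightarrow> P True \<or> P False"
  by (metis (full_types))

text \<open>The layers \<open>P, Q, R\<close> of the digraph are copies of \<^typ>\<open>bool\<close>, negation is the mate, and the weight
\<open>a p q\<close> belongs to the arc from \<open>p\<close> to the mate of \<open>q\<close>. Charging \<open>m\<close> to each passage from \<open>R\<close> back to \<open>P\<close>,
the hypotheses say that the simple closed walks, of length 3 and 6, have weight at most 0.
Then the largest weight of a walk to one fixed vertex is a potential. Walks between vertices of \<open>P\<close> suffice,
for one can shortcut through the \<open>2 \<times> 2\<close> max-plus matrix \<open>T\<close> of a full turn.\<close>

lemma circulation_potential:
  fixes a b c :: "bool \<Rightarrow> bool \<Rightarrow> real" and m :: real
  assumes short: "\<And>p q r. a p q + b (\<not> q) r + c (\<not> r) (\<not> p) \<le> m"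
    and long: "\<And>q r. a True q + b q r + c r True + a False (\<not> q) + b (\<not> q) (\<not> r) + c (\<not> r) False \<le> 2 * m"
  obtains f g h :: "bool \<Rightarrow> real"
  where "\<And>p q. a p q \<le> f p - g (\<not> q)" "\<And>q r. b q r \<le> g q - h (\<not> r)"
    "\<And>r p. c r p \<le> h r - f (\<not> p) + m"
proof -
  define ac where "ac q p = max (b q True + c False p) (b q False + c True p) - m" for q p
  \<comment> \<open>the best walk of length 3 from \<open>p\<close> to \<open>p'\<close>; the potential is normalised to 0 at \<open>True\<close>\<close>
  define T where "T p p' = max (a p True + ac False (\<not> p')) (a p False + ac True (\<not> p'))" for p p'
  define f where "f p = (if p then 0 else T False True)" for p
  define h where "h r = max (c r False + f True) (c r True + f False) - m" for r
  define g where "g q = max (b q True + h False) (b q False + h True)" for q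
  have T: "\<exists>q r. T p p' = a p q + b (\<not> q) r + c (\<not> r) (\<not> p') - m" for p p'
    unfolding T_def ac_def ex_bool by (auto simp: max_def)
  have diag: "T p p \<le> 0" for p
    using T[of p p] short by (metis diff_le_0_iff_le)
  have off: "T True False + T False True \<le> 0"
  proof -
    obtain q r where 1: "T True False = a True q + b (\<not> q) r + c (\<not> r) True - m"
      using T[of True False] by auto
    obtain q' r' where 2: "T False True = a False q' + b (\<not> q') r' + c (\<not> r') False - m"
      using T[of False True] by auto
    have "\<forall>p q r. a p q + b (\<not> q) r + c (\<not> r) (\<not> p) \<le> m"
      using short by blast
    note s = this[unfolded forall_bool, simplified]
    \<comment> \<open>A closed walk of length 6 through both vertices of \<open>P\<close> is either simple or, when its two turns
    meet in \<open>Q\<close> or \<open>R\<close>, a union of two closed walks of length 3.\<close>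
    show ?thesis unfolding 1 2 using s long[of q "\<not> r"]
      by (cases q; cases r; cases q'; cases r'; simp)
  qed
  have Tf: "T p p' + f p' \<le> f p" for p p'
    using diag off by (cases p; cases p'; simp add: f_def)
  have 3: "c r p \<le> h r - f (\<not> p) + m" for r p
    unfolding h_def by (cases p) auto
  have 2: "b q r \<le> g q - h (\<not> r)" for q r
    unfolding g_def by (cases r) auto
  have 1: "a p q \<le> f p - g (\<not> q)" for p q
    using Tf[of p True] Tf[of p False] unfolding T_def g_def h_def ac_def
    by (cases q) (simp_all add: max_def split: if_splits)
  show ?thesis using that 1 2 3 by blast
qed

text \<open>Undoing the twist: the value at a vertex and the value at its mate have a sum that is constant
on each layer, so \<open>f p - g (mate of q)\<close> becomes a sum \<open>x p + y q\<close> after a shift of each layer.\<close>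

lemma tripod_potential:
  fixes a b c :: "bool \<Rightarrow> bool \<Rightarrow> real" and m :: real
  assumes "\<And>p q r. a p q + b (\<not> q) r + c (\<not> r) (\<not> p) \<le> m"
    and "\<And>q r. a True q + b q r + c r True + a False (\<not> q) + b (\<not> q) (\<not> r) + c (\<not> r) False \<le> 2 * m"
  obtains x y z :: "bool \<Rightarrow> real"
  where "\<And>p q. a p q \<le> x p + y q" "\<And>q r. b q r \<le> y q + z r" "\<And>r p. c r p \<le> z r + x p"
    "x True + x False + y True + y False + z True + z False = m"
proof -
  obtain f g h where f: "\<And>p q. a p q \<le> f p - g (\<not> q)"
    and g: "\<And>q r. b q r \<le> g q - h (\<not> r)" and h: "\<And>r p. c r p \<le> h r - f (\<not> p) + m"
    by (rule circulation_potential[where a = a and b = b and c = c and m = m]) (use assms in blast)+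
  define F G H where "F = f True + f False" and "G = g True + g False" and "H = h True + h False"
  \<comment> \<open>the shifts solve \<open>s + t = - G\<close>, \<open>t + w = - H\<close> and \<open>w + s = m - F\<close>\<close>
  define s t w where "s = (m - F - G + H) / 2" and "t = (F - G - H - m) / 2"
    and "w = (m - F + G - H) / 2"
  note defs = F_def G_def H_def s_def t_def w_def
  show ?thesis
  proof (rule that[of "\<lambda>p. f p + s" "\<lambda>q. g q + t" "\<lambda>r. h r + w"])
    show "a p q \<le> (f p + s) + (g q + t)" for p q
      using f[of p q] by (cases q) (simp_all add: defs field_simps)
    show "b q r \<le> (g q + t) + (h r + w)" for q r
      using g[of q r] by (cases r) (simp_all add: defs field_simps)
    show "c r p \<le> (h r + w) + (f p + s)" for r p
      using h[of r p] by (cases p) (simp_all add: defs field_simps)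
  qed (simp add: defs field_simps)
qed

section \<open>The polytope and its twelve vertices\<close>

definition tripod_vertices :: "(real^15) set" where
  "tripod_vertices =
            {(1/2) *\<^sub>R vector [1, 0, 0, 0, 1, 0, 1, 0, 0, 1, 1, 0, 0, 0, 1],
             (1/2) *\<^sub>R vector [1, 0, 1, 0, 0, 0, 0, 0, 1, 1, 1, 0, 0, 0, 1],
             (1/2) *\<^sub>R vector [1, 0, 0, 1, 0, 0, 1, 0, 0, 1, 0, 1, 0, 0, 1],
             (1/2) *\<^sub>R vector [1, 0, 1, 0, 0, 0, 0, 1, 0, 1, 0, 1, 0, 0, 1],
             (1/4) *\<^sub>R vector [2, 1, 0, 0, 1, 0, 1, 1, 0, 2, 0, 1, 1, 0, 2],
             (1/4) *\<^sub>R vector [2, 0, 1, 1, 0, 1, 0, 0, 1, 2, 0, 1, 1, 0, 2],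
             (1/2) *\<^sub>R vector [1, 0, 0, 0, 1, 1, 0, 0, 0, 1, 0, 0, 1, 0, 1],
             (1/2) *\<^sub>R vector [1, 1, 0, 0, 0, 0, 0, 0, 1, 1, 0, 0, 1, 0, 1],
             (1/4) *\<^sub>R vector [2, 0, 1, 0, 1, 1, 0, 1, 0, 2, 1, 0, 0, 1, 2],
             (1/4) *\<^sub>R vector [2, 1, 0, 1, 0, 0, 1, 0, 1, 2, 1, 0, 0, 1, 2],
             (1/2) *\<^sub>R vector [1, 0, 0, 1, 0, 1, 0, 0, 0, 1, 0, 0, 0, 1, 1],
             (1/2) *\<^sub>R vector [1, 1, 0, 0, 0, 0, 0, 1, 0, 1, 0, 0, 0, 1, 1]}"

text \<open>The equations of all nine edges, solved for the three coordinates of the moustaches.\<close>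

definition tripod_polytope :: "(real^15) set" where
  "tripod_polytope = {x. (\<forall>k. 0 \<le> x $ k) \<and>
     x $ 1 = 1/2 \<and> x $ 10 = 1/2 \<and> x $ 15 = 1/2 \<and>
     x $ 2 + x $ 3 + x $ 4 + x $ 5 = 1/2 \<and>
     x $ 6 + x $ 7 + x $ 8 + x $ 9 = 1/2 \<and>
     x $ 2 + x $ 6 + x $ 11 + x $ 12 = 1/2 \<and>
     x $ 3 + x $ 7 + x $ 13 + x $ 14 = 1/2 \<and>
     x $ 4 + x $ 8 + x $ 11 + x $ 13 = 1/2 \<and>
     x $ 5 + x $ 9 + x $ 12 + x $ 14 = 1/2}"

lemma inner_15: "x \<bullet> y = x $ 1 * y $ 1 + x $ 2 * y $ 2 + x $ 3 * y $ 3 + x $ 4 * y $ 4 + x $ 5 * y $ 5 +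
   x $ 6 * y $ 6 + x $ 7 * y $ 7 + x $ 8 * y $ 8 + x $ 9 * y $ 9 + x $ 10 * y $ 10 + x $ 11 * y $ 11 +
   x $ 12 * y $ 12 + x $ 13 * y $ 13 + x $ 14 * y $ 14 + x $ 15 * y $ 15" for x y :: "real^15"
  by (simp add: inner_vec_def sum_15)

text \<open>The dual optimum. The eight matchings are the closed walks of length 3 and the four pairs of
triangles those of length 6, so the bounds on the twelve points are the two hypotheses on closed walks.\<close>

lemma dual_solution:
  fixes d :: "real^15"
  assumes "\<And>v. v \<in> tripod_vertices \<Longrightarrow> d \<bullet> v \<le> m"
  obtains u1 u2 u3 u4 u5 u6 :: real
  where "d $ 2 \<le> u1 + u3" "d $ 3 \<le> u1 + u4" "d $ 4 \<le> u1 + u5" "d $ 5 \<le> u1 + u6"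
    "d $ 6 \<le> u2 + u3" "d $ 7 \<le> u2 + u4" "d $ 8 \<le> u2 + u5" "d $ 9 \<le> u2 + u6"
    "d $ 11 \<le> u3 + u5" "d $ 12 \<le> u3 + u6" "d $ 13 \<le> u4 + u5" "d $ 14 \<le> u4 + u6"
    "u1 + u2 + u3 + u4 + u5 + u6 + d $ 1 + d $ 10 + d $ 15 = 2 * m"
proof -
  define a where "a p q = (if p then if q then d $ 2 else d $ 3 else if q then d $ 6 else d $ 7)" for p q
  define b where "b q r = (if q then if r then d $ 11 else d $ 12 else if r then d $ 13 else d $ 14)" for q r
  define c where "c r p = (if p then if r then d $ 4 else d $ 5 else if r then d $ 8 else d $ 9)" for p r
  define n where "n = 2 * m - d $ 1 - d $ 10 - d $ 15"
  have "\<forall>v\<in>tripod_vertices. d \<bullet> v \<le> m" using assms by blast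
  note v = this[unfolded tripod_vertices_def inner_15, simplified]
  have short: "a p q + b (\<not> q) r + c (\<not> r) (\<not> p) \<le> n" for p q r
    using v unfolding a_def b_def c_def n_def by (cases p; cases q; cases r; simp)
  have long: "a True q + b q r + c r True + a False (\<not> q) + b (\<not> q) (\<not> r) + c (\<not> r) False \<le> 2 * n" for q r
    using v unfolding a_def b_def c_def n_def by (cases q; cases r; simp)
  obtain x y z where x: "\<And>p q. a p q \<le> x p + y q" "\<And>q r. b q r \<le> y q + z r" "\<And>r p. c r p \<le> z r + x p"
    "x True + x False + y True + y False + z True + z False = n"
    by (rule tripod_potential[where a = a and b = b and c = c and m = n]) (use short long in blast)+
  show ?thesis
  proof (rule that[of "x True" "y True" "y False" "z True" "z False" "x False"])
  qed (use x(1)[of True True] x(1)[of True False] x(1)[of False True] x(1)[of False False]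
      x(2)[of True True] x(2)[of True False] x(2)[of False True] x(2)[of False False]
      x(3)[of True True] x(3)[of True False] x(3)[of False True] x(3)[of False False] x(4) in
      \<open>simp_all add: a_def b_def c_def n_def add.commute\<close>)
qed

lemma tripod_vertices_subset: "tripod_vertices \<subseteq> tripod_polytope"
  unfolding tripod_vertices_def tripod_polytope_def by (simp add: forall_15)

lemma finite_tripod_vertices: "finite tripod_vertices"
  unfolding tripod_vertices_def by simp

lemma convex_tripod_polytope: "convex tripod_polytope"
proof (rule convexI)
  fix x y :: "real^15" and u v :: real
  assume xy: "x \<in> tripod_polytope" "y \<in> tripod_polytope" and uv: "0 \<le> u" "0 \<le> v" "u + v = 1"
  have half: "u * s + v * t = 1/2" if "s = 1/2" "t = 1/2" for s t
  proof -
    have "u * s + v * t = (u + v) / 2" unfolding that by simp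
    then show ?thesis using uv(3) by simp
  qed
  have four: "u * s1 + v * t1 + (u * s2 + v * t2) + (u * s3 + v * t3) + (u * s4 + v * t4) = 1/2"
    if "s1 + s2 + s3 + s4 = 1/2" "t1 + t2 + t3 + t4 = 1/2" for s1 s2 s3 s4 t1 t2 t3 t4
    using half[OF that] by (simp only: distrib_left ac_simps)
  show "u *\<^sub>R x + v *\<^sub>R y \<in> tripod_polytope"
    unfolding tripod_polytope_def mem_Collect_eq vector_add_component vector_scaleR_component real_scaleR_def
    by (intro conjI allI add_nonneg_nonneg mult_nonneg_nonneg half four)
       (use xy uv in \<open>simp_all add: tripod_polytope_def\<close>)
qed

text \<open>Bounding \<open>d\<^sub>i\<^sub>j\<close> by \<open>u\<^sub>i + u\<^sub>j\<close> and collecting the terms of each \<open>u\<^sub>i\<close> leaves the matching equation at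
the leaf \<open>i\<close>.\<close>

lemma tripod_polytope_weak_duality:
  assumes x: "x \<in> tripod_polytope" and v: "\<And>v. v \<in> tripod_vertices \<Longrightarrow> d \<bullet> v \<le> m"
  shows "d \<bullet> x \<le> m"
proof -
  obtain u1 u2 u3 u4 u5 u6 where u:
    "d $ 2 \<le> u1 + u3" "d $ 3 \<le> u1 + u4" "d $ 4 \<le> u1 + u5" "d $ 5 \<le> u1 + u6"
    "d $ 6 \<le> u2 + u3" "d $ 7 \<le> u2 + u4" "d $ 8 \<le> u2 + u5" "d $ 9 \<le> u2 + u6"
    "d $ 11 \<le> u3 + u5" "d $ 12 \<le> u3 + u6" "d $ 13 \<le> u4 + u5" "d $ 14 \<le> u4 + u6"
    "u1 + u2 + u3 + u4 + u5 + u6 + d $ 1 + d $ 10 + d $ 15 = 2 * m"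
    by (rule dual_solution[of d m, OF v])
  from x have pos: "0 \<le> x $ k" for k by (simp add: tripod_polytope_def)
  have "d \<bullet> x \<le> d $ 1 * x $ 1 + (u1 + u3) * x $ 2 + (u1 + u4) * x $ 3 + (u1 + u5) * x $ 4 + (u1 + u6) * x $ 5 +
    (u2 + u3) * x $ 6 + (u2 + u4) * x $ 7 + (u2 + u5) * x $ 8 + (u2 + u6) * x $ 9 + d $ 10 * x $ 10 +
    (u3 + u5) * x $ 11 + (u3 + u6) * x $ 12 + (u4 + u5) * x $ 13 + (u4 + u6) * x $ 14 + d $ 15 * x $ 15"
    unfolding inner_15 by (intro add_mono mult_right_mono u pos order_refl)
  also have "\<dots> = d $ 1 * x $ 1 + d $ 10 * x $ 10 + d $ 15 * x $ 15
     + u1 * (x $ 2 + x $ 3 + x $ 4 + x $ 5) + u2 * (x $ 6 + x $ 7 + x $ 8 + x $ 9)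
     + u3 * (x $ 2 + x $ 6 + x $ 11 + x $ 12) + u4 * (x $ 3 + x $ 7 + x $ 13 + x $ 14)
     + u5 * (x $ 4 + x $ 8 + x $ 11 + x $ 13) + u6 * (x $ 5 + x $ 9 + x $ 12 + x $ 14)"
    by (simp only: distrib_left distrib_right ac_simps)
  also have "\<dots> = (u1 + u2 + u3 + u4 + u5 + u6 + d $ 1 + d $ 10 + d $ 15) / 2"
  proof -
    from x have e: "x $ 1 = 1/2" "x $ 10 = 1/2" "x $ 15 = 1/2"
      "x $ 2 + x $ 3 + x $ 4 + x $ 5 = 1/2" "x $ 6 + x $ 7 + x $ 8 + x $ 9 = 1/2"
      "x $ 2 + x $ 6 + x $ 11 + x $ 12 = 1/2" "x $ 3 + x $ 7 + x $ 13 + x $ 14 = 1/2"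
      "x $ 4 + x $ 8 + x $ 11 + x $ 13 = 1/2" "x $ 5 + x $ 9 + x $ 12 + x $ 14 = 1/2"
      unfolding tripod_polytope_def by blast+
    show ?thesis unfolding e by (simp add: add_divide_distrib)
  qed
  also have "\<dots> = m" using u(13) by simp
  finally show ?thesis .
qed

text \<open>A point outside the hull would be separated from it by a functional that the twelve points
bound, against weak duality.\<close>

lemma tripod_polytope_eq_hull: "tripod_polytope = convex hull tripod_vertices"
proof (rule antisym)
  show "convex hull tripod_vertices \<subseteq> tripod_polytope"
    using tripod_vertices_subset convex_tripod_polytope by (simp add: subset_hull)
  show "tripod_polytope \<subseteq> convex hull tripod_vertices"
  proof (rule ccontr)
    assume "\<not> tripod_polytope \<subseteq> convex hull tripod_vertices"
    then obtain x where x: "x \<in> tripod_polytope" "x \<notin> convex hull tripod_vertices" by blast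
    have cl: "closed (convex hull tripod_vertices)"
      by (simp add: compact_imp_closed finite_imp_compact_convex_hull finite_tripod_vertices)
    obtain d \<beta> where d: "d \<bullet> x < \<beta>" "\<forall>y\<in>convex hull tripod_vertices. d \<bullet> y > \<beta>"
      using separating_hyperplane_closed_point[OF convex_convex_hull cl x(2)] by blast
    have "- d \<bullet> v \<le> - \<beta>" if "v \<in> tripod_vertices" for v
      using d(2)[rule_format, OF hull_inc[OF that]] by simp
    then have "- d \<bullet> x \<le> - \<beta>" by (rule tripod_polytope_weak_duality[OF x(1)])
    with d(1) show False by simp
  qed
qed

text \<open>Both ends of a segment through \<open>v\<close> vanish wherever \<open>v\<close> does, because coordinates are nonnegative.\<close>

lemma extreme_of_support:
  assumes v: "v \<in> tripod_polytope"
    and uniq: "\<And>x. x \<in> tripod_polytope \<Longrightarrow> (\<And>k. v $ k = 0 \<Longrightarrow> x $ k = 0) \<Longrightarrow> x = v"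
  shows "v extreme_point_of tripod_polytope"
  unfolding extreme_point_of_def
proof (intro conjI ballI notI v)
  fix x y assume x: "x \<in> tripod_polytope" and y: "y \<in> tripod_polytope" and seg: "v \<in> open_segment x y"
  then obtain t where t: "0 < t" "t < 1" "v = (1 - t) *\<^sub>R x + t *\<^sub>R y" and ne: "x \<noteq> y"
    by (auto simp: in_segment)
  have "x $ k = 0 \<and> y $ k = 0" if "v $ k = 0" for k
  proof -
    have "0 \<le> x $ k" "0 \<le> y $ k" using x y by (simp_all add: tripod_polytope_def)
    moreover have "(1 - t) * x $ k + t * y $ k = 0" using that t by simp
    ultimately show ?thesis using t(1,2) by (simp add: add_nonneg_eq_0_iff)
  qed
  then have "x = v" "y = v" using uniq x y by blast+
  with ne show False by simp
qed


text \<open>On the support of a perfect matching the equations leave no freedom; on two triangles neither,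
because odd cycles have a nonsingular incidence matrix.\<close>

lemma extreme_points_tripod_polytope: "{x. x extreme_point_of tripod_polytope} = tripod_vertices"
proof (intro antisym subsetI; clarify?)
  fix x assume "x extreme_point_of tripod_polytope"
  then show "x \<in> tripod_vertices" unfolding tripod_polytope_eq_hull by (rule extreme_point_of_convex_hull)
next
  fix v assume v: "v \<in> tripod_vertices"
  show "v extreme_point_of tripod_polytope"
  proof (rule extreme_of_support)
    show "v \<in> tripod_polytope" using v tripod_vertices_subset by blast
    fix x assume "x \<in> tripod_polytope" and "\<And>k. v $ k = 0 \<Longrightarrow> x $ k = 0"
    then have "\<forall>k. v $ k = 0 \<longrightarrow> x $ k = 0" by blast
    with v \<open>x \<in> tripod_polytope\<close> show "x = v"
      unfolding tripod_vertices_def tripod_polytope_def insert_iff empty_iff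
      by (elim disjE; simp add: forall_15 vec_eq_iff; linarith?)
  qed
qed

lemma card_tripod_vertices: "card tripod_vertices = 12"
proof -
  \<comment> \<open>any functional that takes twelve different values would do\<close>
  let ?f = "\<lambda>x::real^15. 4 * (x $ 2 + 3 * x $ 3 + 2 * x $ 4 + 4 * x $ 6 + 4 * x $ 8)"
  have "card (?f ` tripod_vertices) = 12" 
    unfolding tripod_vertices_def image_insert image_empty by simp
  then have "12 \<le> card tripod_vertices" using card_image_le[OF finite_tripod_vertices, of ?f] by simp
  moreover have "card tripod_vertices \<le> 12"
    unfolding tripod_vertices_def by (intro card_insert_le_m1 | simp)+
  ultimately show ?thesis by simp
qed

text \<open>The barycentre \<open>c\<close> has positive coordinates, so near it only the equations matter. Their
homogeneous solutions are parametrised by the coordinates \<open>\<lambda>\<^sub>1\<^sub>3, \<lambda>\<^sub>1\<^sub>4, \<lambda>\<^sub>1\<^sub>5, \<lambda>\<^sub>2\<^sub>3, \<lambda>\<^sub>2\<^sub>5, \<lambda>\<^sub>3\<^sub>5\<close>.\<close>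

lemma aff_dim_tripod_polytope: "aff_dim tripod_polytope = 6"
proof -
  define c :: "real^15" where
    "c = vector [1/2, 1/8, 1/8, 1/8, 1/8, 1/8, 1/8, 1/8, 1/8, 1/2, 1/8, 1/8, 1/8, 1/8, 1/2]"
  define L :: "real^6 \<Rightarrow> real^15" where
    "L y = vector [0, y $ 1, y $ 2, y $ 3, - y $ 1 - y $ 2 - y $ 3, y $ 4, - y $ 1 - y $ 2 - y $ 4,
       y $ 5, y $ 1 + y $ 2 - y $ 5, 0, y $ 6, - y $ 1 - y $ 4 - y $ 6, - y $ 3 - y $ 5 - y $ 6,
       y $ 1 + y $ 3 + y $ 4 + y $ 5 + y $ 6, 0]" for y
  have lin: "linear L"
    by (rule linearI) (simp_all add: L_def vec_eq_iff forall_15 algebra_simps)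
  have inj: "inj L"
  proof (rule injI)
    fix y z assume "L y = L z"
    then have "L y $ k = L z $ k" for k by simp
    from this[of 2] this[of 3] this[of 4] this[of 6] this[of 8] this[of 11]
    have "\<forall>k\<in>{1, 2, 3, 4, 5, 6}. y $ k = z $ k" unfolding L_def by simp
    then show "y = z" unfolding vec_eq_iff using exhaust_6 by blast
  qed
  define D where "D = {y. c + L y \<in> tripod_polytope}"
  have "tripod_polytope = (+) c ` L ` D"
  proof (intro antisym subsetI)
    fix x assume x: "x \<in> tripod_polytope"
    define y :: "real^6" where "y = vector [x $ 2 - 1/8, x $ 3 - 1/8, x $ 4 - 1/8, x $ 6 - 1/8,
      x $ 8 - 1/8, x $ 11 - 1/8]"
    have y: "y $ 1 = x $ 2 - 1/8" "y $ 2 = x $ 3 - 1/8" "y $ 3 = x $ 4 - 1/8" "y $ 4 = x $ 6 - 1/8"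
      "y $ 5 = x $ 8 - 1/8" "y $ 6 = x $ 11 - 1/8"
      unfolding y_def vector_def by simp_all
    have "c + L y = x"
      using x unfolding vec_eq_iff forall_15 tripod_polytope_def
      by (simp add: c_def L_def y)
    then show "x \<in> (+) c ` L ` D" using x unfolding D_def by blast
  qed (auto simp: D_def)
  moreover have "aff_dim D = 6"
  proof -
    define U where "U = {y. \<forall>k. 0 < (c + L y) $ k}"
    have "U = (\<Inter>k. {y. 0 < (c + L y) $ k})" unfolding U_def by blast
    moreover have "open {y. 0 < (c + L y) $ k}" for k
      by (intro open_Collect_less continuous_intros linear_continuous_on_compose[OF _ lin] continuous_on_component)
    ultimately have "open U" by (simp add: open_INT)
    moreover have "0 \<in> U" unfolding U_def by (simp add: forall_15 c_def linear_0[OF lin])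
    moreover have "U \<subseteq> D" unfolding U_def D_def tripod_polytope_def
      by (auto simp: c_def L_def less_imp_le)
    ultimately have "interior D \<noteq> {}" using interior_maximal by blast
    then show ?thesis by (simp add: aff_dim_nonempty_interior)
  qed
  moreover have "aff_dim ((+) c ` L ` D) = aff_dim D"
    by (simp only: aff_dim_translation_eq aff_dim_injective_linear_image[OF lin inj])
  ultimately show ?thesis by simp
qed

section \<open>Forests\<close>

lemma graph_path_successively:
  "graph_path V E xs \<longleftrightarrow>
    xs \<noteq> [] \<and> set xs \<subseteq> V \<and> distinct xs \<and> successively (\<lambda>x y. {x, y} \<in> E) xs"
  unfolding graph_path_def successively_conv_nth by auto

lemma simple_graph_edge:
  assumes "simple_graph V E" "e \<in> E"
  obtains x y where "e = {x, y}" "x \<in> V" "y \<in> V" "x \<noteq> y"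
  using assms unfolding simple_graph_def card_2_iff by blast

lemma simple_graph_edgeD:
  assumes "simple_graph V E" "{x, y} \<in> E"
  shows "x \<in> V" "y \<in> V" "x \<noteq> y"
  using assms unfolding simple_graph_def by auto

lemma finite_edges: "simple_graph V E \<Longrightarrow> finite E"
  by (rule finite_subset[of E "Pow V"]) (auto simp: simple_graph_def)

lemma edge_at_vertex:
  assumes "simple_graph V E" "e \<in> E" "v \<in> e"
  obtains w where "e = {v, w}" "w \<in> V" "w \<noteq> v"
proof -
  obtain x y where xy: "e = {x, y}" "x \<in> V" "y \<in> V" "x \<noteq> y"
    using simple_graph_edge[OF assms(1,2)] .
  then consider "v = x" | "v = y" using assms(3) by blast
  then show thesis
  proof cases
    case 1
    then show ?thesis using that[of y] xy by simp
  next
    case 2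
    then show ?thesis using that[of x] xy by (simp add: insert_commute)
  qed
qed

text \<open>The first vertex of a longest path has all its neighbours on the path; a neighbour other than
the second vertex would close a cycle.\<close>

lemma forest_low_degree:
  assumes G: "simple_graph V E" and "V \<noteq> {}" and acyc: "\<nexists>xs. graph_cycle V E xs"
  obtains v where "v \<in> V" "vertex_degree E v \<le> 1"
proof -
  have fin: "finite V" using G by (simp add: simple_graph_def)
  obtain v0 where "v0 \<in> V" using \<open>V \<noteq> {}\<close> by blast
  then have P0: "graph_path V E [v0]" by (simp add: graph_path_successively)
  have bound: "\<forall>xs. graph_path V E xs \<longrightarrow> length xs < Suc (card V)"
    by (metis graph_path_def card_mono distinct_card fin less_Suc_eq_le)
  obtain xs where xs: "graph_path V E xs"
    and max: "\<And>ys. graph_path V E ys \<Longrightarrow> length ys \<le> length xs"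
    using ex_has_greatest_nat[of "graph_path V E", OF P0 bound] by blast
  then obtain u ys where ux: "xs = u # ys" by (cases xs) (auto simp: graph_path_def)
  have nbr: "w \<in> set xs" if "{u, w} \<in> E" for w
  proof (rule ccontr)
    assume "w \<notin> set xs"
    then have "graph_path V E (w # xs)"
      using xs that simple_graph_edgeD[OF G that]
      by (simp add: graph_path_successively ux insert_commute)
    from max[OF this] show False by simp
  qed
  have "vertex_degree E u \<le> 1"
  proof (rule ccontr)
    assume "\<not> vertex_degree E u \<le> 1"
    then have "\<not> card {e \<in> E. u \<in> e} \<le> Suc 0" by (simp add: vertex_degree_def)
    then obtain e1 e2 where e: "e1 \<in> E" "e2 \<in> E" "u \<in> e1" "u \<in> e2" "e1 \<noteq> e2"
      using finite_edges[OF G] by (auto simp: card_le_Suc0_iff_eq)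
    obtain w1 where w1: "e1 = {u, w1}" "w1 \<noteq> u" using edge_at_vertex[OF G e(1,3)] by blast
    obtain w2 where w2: "e2 = {u, w2}" "w2 \<noteq> u" using edge_at_vertex[OF G e(2,4)] by blast
    note w = w1 w2
    then have "w1 \<noteq> w2" "w1 \<in> set ys" "w2 \<in> set ys"
      using e nbr[of w1] nbr[of w2] ux by auto
    then have "\<exists>w. w \<in> set ys \<and> {u, w} \<in> E \<and> w \<noteq> hd ys"
      using w e by (cases "w1 = hd ys") auto
    then obtain w where w: "w \<in> set ys" "{u, w} \<in> E" "w \<noteq> hd ys" by blast
    then obtain as bs where ys: "ys = as @ w # bs" by (meson split_list)
    with w(3) have "as \<noteq> []" by auto
    have "graph_path V E ((u # as @ [w]) @ bs)" using xs ys ux by simp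
    then have "graph_path V E (u # as @ [w])"
      unfolding graph_path_successively successively_append_iff[of _ "u # as @ [w]"] by auto
    then have "graph_cycle V E (u # as @ [w])"
      using \<open>as \<noteq> []\<close> w(2) by (cases as) (auto simp: graph_cycle_def insert_commute)
    with acyc show False by blast
  qed
  moreover have "u \<in> V" using xs ux by (simp add: graph_path_def)
  ultimately show ?thesis using that by blast
qed

lemma forest_card_edges:
  assumes "simple_graph V E" and "V \<noteq> {}" and "\<nexists>xs. graph_cycle V E xs"
  shows "card E < card V"
  using assms
proof (induction "card V" arbitrary: V E rule: less_induct)
  case less
  note G = less.prems(1)
  have fin: "finite V" using G by (simp add: simple_graph_def)
  obtain v where v: "v \<in> V" "vertex_degree E v \<le> 1"
    using forest_low_degree[OF less.prems] .
  let ?V = "V - {v}" and ?E = "{e \<in> E. v \<notin> e}"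
  have G': "simple_graph ?V ?E" using G unfolding simple_graph_def by auto
  have "card E = card ?E + card {e \<in> E. v \<in> e}"
    by (subst card_Un_disjoint[symmetric]) (auto simp: finite_edges[OF G] intro!: arg_cong[of _ _ card])
  then have E: "card E \<le> card ?E + 1" using v by (simp add: vertex_degree_def)
  have V: "card V = Suc (card ?V)" using v fin by (metis card_Suc_Diff1)
  show ?case
  proof (cases "?V = {}")
    case True
    have "E = {}"
    proof (rule ccontr)
      assume "E \<noteq> {}"
      then obtain e where "e \<subseteq> V" "card e = 2" using G unfolding simple_graph_def by blast
      moreover from this True have "e \<subseteq> {v}" by blast
      ultimately show False using card_mono[of "{v}" e] by simp
    qed
    then show ?thesis using V by simp
  next
    case False
    have "\<nexists>xs. graph_cycle ?V ?E xs"
      using less.prems(3) unfolding graph_cycle_def graph_path_def by blast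
    then have "card ?E < card ?V" using less.hyps[OF _ G' False] V by simp
    then show ?thesis using E V by simp
  qed
qed

lemma handshake:
  assumes G: "simple_graph V E"
  shows "(\<Sum>v\<in>V. vertex_degree E v) = 2 * card E"
proof -
  have fin: "finite V" "finite E" using G finite_edges[OF G] by (simp_all add: simple_graph_def)
  have "(\<Sum>v\<in>V. vertex_degree E v) = (\<Sum>v\<in>V. \<Sum>e\<in>E. if v \<in> e then 1 else 0)"
    unfolding vertex_degree_def using fin by (simp add: sum.inter_filter[symmetric])
  also have "\<dots> = (\<Sum>e\<in>E. \<Sum>v\<in>V. if v \<in> e then 1 else 0)" by (rule sum.swap)
  also have "\<dots> = (\<Sum>e\<in>E. card e)"
  proof (rule sum.cong[OF refl])
    fix e assume "e \<in> E"
    then have "{v \<in> V. v \<in> e} = e" using G unfolding simple_graph_def by auto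
    then show "(\<Sum>v\<in>V. if v \<in> e then 1 else 0) = card e"
      using fin by (simp add: sum.inter_filter[symmetric])
  qed
  also have "\<dots> = (\<Sum>e\<in>E. 2)" using G unfolding simple_graph_def by (intro sum.cong) auto
  finally show ?thesis by simp
qed

section \<open>Paths and components\<close>

text \<open>Where two paths first part, follow one of them until it meets the other and return along that one:
a cycle.\<close>

lemma forest_unique_path:
  assumes acyc: "\<nexists>zs. graph_cycle V E zs"
    and "graph_path V E xs" "graph_path V E ys" "hd xs = hd ys" "last xs = last ys"
  shows "xs = ys"
  using assms(2-)
proof (induction xs arbitrary: ys)
  case Nil
  then show ?case by (simp add: graph_path_def)
next
  case (Cons u xs)
  then obtain ys' where ys: "ys = u # ys'" by (cases ys) (auto simp: graph_path_def)
  show ?case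
  proof (cases "xs = [] \<or> ys' = []")
    case True
    then show ?thesis using Cons.prems ys
      by (metis distinct.simps(2) graph_path_def last.simps last_in_set)
  next
    case False
    then have ne: "xs \<noteq> []" "ys' \<noteq> []" by auto
    have px: "graph_path V E xs" and py: "graph_path V E ys'"
      and ux: "{u, hd xs} \<in> E" "u \<notin> set xs" and uy: "{u, hd ys'} \<in> E" "u \<notin> set ys'" and "u \<in> V"
      using Cons.prems ne by (auto simp: ys graph_path_successively successively_Cons)
    have last: "last xs = last ys'" using Cons.prems ne by (simp add: ys)
    show ?thesis
    proof (cases "hd xs = hd ys'")
      case True
      then show ?thesis using Cons.IH[OF px py] last ys by simp
    next
      case False
      have "\<exists>w\<in>set xs. w \<in> set ys'" using last ne by (metis last_in_set)
      then obtain as w bs where xs: "xs = as @ w # bs" "w \<in> set ys'" "\<forall>z\<in>set as. z \<notin> set ys'"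
        using split_list_first_prop[of xs "\<lambda>z. z \<in> set ys'"] by blast
      then obtain cs ds where cs: "ys' = cs @ w # ds" by (metis split_list)
      let ?Z = "u # as @ w # rev cs"
      have "as \<noteq> [] \<or> cs \<noteq> []" using False xs cs by auto
      then have "3 \<le> length ?Z" by (cases as; cases cs) auto
      moreover have "last ?Z = hd ys'" using cs by (cases cs) auto
      moreover have "graph_path V E ?Z"
      proof -
        have "successively (\<lambda>x y. {x, y} \<in> E) ((u # as) @ w # rev cs)"
          unfolding successively_append_iff
        proof (intro conjI impI)
          show "successively (\<lambda>x y. {x, y} \<in> E) (u # as)"
          proof -
            have "successively (\<lambda>x y. {x, y} \<in> E) as"
              using px unfolding xs graph_path_successively successively_append_iff by blast
            then show ?thesis using ux(1) by (cases as) (simp_all add: xs)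
          qed
          have "successively (\<lambda>x y. {x, y} \<in> E) (cs @ [w])"
            using py by (auto simp: cs graph_path_successively successively_append_iff)
          then have "successively (\<lambda>x y. {x, y} \<in> E) (rev (cs @ [w]))"
            unfolding successively_rev by (simp add: insert_commute)
          then show "successively (\<lambda>x y. {x, y} \<in> E) (w # rev cs)" by simp
          have "{last (u # as), w} \<in> E"
          proof (cases "as = []")
            case True
            then show ?thesis using ux(1) by (simp add: xs)
          next
            case False
            then show ?thesis
              using px unfolding xs graph_path_successively successively_append_iff by simp
          qed
          then show "u # as = [] \<or> w # rev cs = [] \<or> {last (u # as), hd (w # rev cs)} \<in> E" by simp
        qed
        then show ?thesis using px py ux uy \<open>u \<in> V\<close> xs cs
          by (auto simp: graph_path_successively)
      qed
      ultimately have "graph_cycle V E ?Z"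
        using uy(1) by (simp add: graph_cycle_def insert_commute)
      with acyc show ?thesis by blast
    qed
  qed
qed

lemma tree_path_eq:
  assumes "tree_graph V E" and "path_joining V E u v xs"
  shows "tree_path V E u v = path_edges xs"
proof -
  have "(THE ys. path_joining V E u v ys) = xs"
    using assms forest_unique_path[of V E]
    by (intro the_equality) (auto simp: path_joining_def tree_graph_def)
  then show ?thesis by (simp add: tree_path_def)
qed

lemma path_edges_simps [simp]:
  "path_edges [x] = {}"
  "path_edges (x # y # zs) = insert {x, y} (path_edges (y # zs))"
proof -
  have "path_edges (x # y # zs) = (\<lambda>k. {(x # y # zs) ! k, (y # zs) ! k}) ` {..<Suc (length zs)}"
    unfolding path_edges_def by auto
  also have "\<dots> = insert {x, y} (path_edges (y # zs))"
    unfolding lessThan_Suc_eq_insert_0 image_insert image_image path_edges_def by auto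
  finally show "path_edges (x # y # zs) = insert {x, y} (path_edges (y # zs))" .
qed (simp add: path_edges_def)

text \<open>Walks may be shortened to paths, which makes joinedness an equivalence relation.\<close>

lemma joined_iff_rtranclp:
  assumes G: "simple_graph V E"
  shows "joined V E u v \<longleftrightarrow> u \<in> V \<and> (\<lambda>x y. {x, y} \<in> E)\<^sup>*\<^sup>* u v"
proof
  have "graph_path V E xs \<Longrightarrow> (\<lambda>x y. {x, y} \<in> E)\<^sup>*\<^sup>* (hd xs) (last xs)" for xs
  proof (induction xs)
    case (Cons x xs)
    then show ?case
      by (cases "xs = []") (auto simp: graph_path_successively successively_Cons
          intro: converse_rtranclp_into_rtranclp)
  qed (simp add: graph_path_def)
  then show "u \<in> V \<and> (\<lambda>x y. {x, y} \<in> E)\<^sup>*\<^sup>* u v" if "joined V E u v"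
    using that by (auto simp: joined_def path_joining_def graph_path_def)
next
  assume "u \<in> V \<and> (\<lambda>x y. {x, y} \<in> E)\<^sup>*\<^sup>* u v"
  then have "u \<in> V" and "(\<lambda>x y. {x, y} \<in> E)\<^sup>*\<^sup>* u v" by auto
  from this(2) show "joined V E u v"
  proof (induction rule: rtranclp_induct)
    case base
    then show ?case using \<open>u \<in> V\<close>
      by (auto simp: joined_def path_joining_def graph_path_successively intro!: exI[of _ "[u]"])
  next
    case (step y z)
    then obtain xs where xs: "graph_path V E xs" "hd xs = u" "last xs = y"
      by (auto simp: joined_def path_joining_def)
    show ?case
    proof (cases "z \<in> set xs")
      case True
      then obtain as bs where "xs = as @ z # bs" by (meson split_list)
      then have as: "xs = (as @ [z]) @ bs" by simp
      have "graph_path V E (as @ [z])"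
        using xs(1) unfolding as graph_path_successively successively_append_iff by auto
      moreover have "hd (as @ [z]) = u" using xs(2) as by (cases as) auto
      ultimately have "path_joining V E u z (as @ [z])"
        by (simp add: path_joining_def)
      then show ?thesis by (auto simp: joined_def)
    next
      case False
      then have "path_joining V E u z (xs @ [z])"
        using xs step.hyps(2) simple_graph_edgeD[OF G step.hyps(2)]
        by (auto simp: path_joining_def graph_path_successively successively_append_iff)
      then show ?thesis by (auto simp: joined_def)
    qed
  qed
qed

lemma components_of_graph_two:
  assumes G: "simple_graph V E" and "V = A \<union> B" "A \<inter> B = {}" "r \<in> A" "s \<in> B"
    and A: "\<And>x. x \<in> A \<Longrightarrow> (\<lambda>x y. {x, y} \<in> E)\<^sup>*\<^sup>* r x"
    and B: "\<And>x. x \<in> B \<Longrightarrow> (\<lambda>x y. {x, y} \<in> E)\<^sup>*\<^sup>* s x"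
    and cut: "\<And>e. e \<in> E \<Longrightarrow> e \<subseteq> A \<or> e \<subseteq> B"
  shows "components_of_graph V E = {A, B}"
proof -
  let ?R = "\<lambda>x y. {x, y} \<in> E"
  have sym: "?R\<^sup>*\<^sup>* y x" if "?R\<^sup>*\<^sup>* x y" for x y
    by (rule sympD[OF symp_rtranclp that]) (simp add: symp_def insert_commute)
  have stay: "y \<in> A \<longleftrightarrow> x \<in> A" if "?R\<^sup>*\<^sup>* x y" for x y
    using that
  proof (induction rule: rtranclp_induct)
    case (step y z)
    then show ?case using cut[of "{y, z}"] \<open>A \<inter> B = {}\<close> by blast
  qed simp
  have conn: "?R\<^sup>*\<^sup>* u v" if "u \<in> A \<and> v \<in> A \<or> u \<in> B \<and> v \<in> B" for u v
    using that rtranclp_trans[OF sym[OF A] A, of u v] rtranclp_trans[OF sym[OF B] B, of u v] by blast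
  have compA: "{v \<in> V. joined V E u v} = A" if "u \<in> A" for u
    unfolding joined_iff_rtranclp[OF G] using that conn[of u] stay[of u] \<open>V = A \<union> B\<close> by blast
  have compB: "{v \<in> V. joined V E u v} = B" if "u \<in> B" for u
    unfolding joined_iff_rtranclp[OF G]
    using that conn[of u] stay[of u] \<open>V = A \<union> B\<close> \<open>A \<inter> B = {}\<close> by blast
  show ?thesis
    unfolding components_of_graph_def
  proof (intro equalityI subsetI)
    fix C assume "C \<in> {{v \<in> V. joined V E u v} | u. u \<in> V}"
    then obtain u where u: "u \<in> A \<or> u \<in> B" "C = {v \<in> V. joined V E u v}"
      unfolding \<open>V = A \<union> B\<close> by blast
    from u(1) show "C \<in> {A, B}" unfolding u(2) by (elim disjE) (simp_all add: compA compB)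
  next
    have "r \<in> V" "s \<in> V" using assms(2,4,5) by simp_all
    moreover fix C assume "C \<in> {A, B}"
    then have "C = {v \<in> V. joined V E r v} \<or> C = {v \<in> V. joined V E s v}"
      by (simp add: compA[OF \<open>r \<in> A\<close>] compB[OF \<open>s \<in> B\<close>])
    ultimately show "C \<in> {{v \<in> V. joined V E u v} | u. u \<in> V}" by blast
  qed
qed

text \<open>The definition compares the traces of the components on the boundary; these are told apart by
the very leaves \<open>u\<close> and \<open>v\<close>.\<close>

lemma separated_by_two:
  assumes "components_of_graph V (E - {e}) = {A, B}" "A \<inter> B = {}"
    "u \<in> boundary V E" "v \<in> boundary V E" "u \<in> A \<union> B" "v \<in> A \<union> B"
  shows "separated_by V E e u v \<longleftrightarrow> (u \<in> A) \<noteq> (v \<in> A)"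
proof -
  let ?X = "boundary V E \<inter> A" and ?Y = "boundary V E \<inter> B"
  have "edge_partition V E e = {?X, ?Y}" by (simp add: edge_partition_def assms(1))
  then have "separated_by V E e u v \<longleftrightarrow> ?X \<noteq> ?Y \<and> (u \<in> ?X \<and> v \<in> ?Y \<or> u \<in> ?Y \<and> v \<in> ?X)"
    unfolding separated_by_def by (simp only: bex_simps) metis
  moreover have "(x \<in> ?X \<longleftrightarrow> x \<in> A) \<and> (x \<in> ?Y \<longleftrightarrow> x \<notin> A)" if "x = u \<or> x = v" for x
    using that assms(2-) by auto
  ultimately show ?thesis by metis
qed

lemma rtranclp_two: "R x y \<Longrightarrow> R y w \<Longrightarrow> R\<^sup>*\<^sup>* x w"
  by (rule rtranclp.rtrancl_into_rtrancl[OF r_into_rtranclp])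

section \<open>The tree with three moustaches\<close>

text \<open>The names of the leaves and hubs are parameters, so that the symmetries of the tree act by
reinterpretation: facts are proved for the first moustache or the first two arms only.\<close>

locale tripod =
  fixes V :: "'a set" and E :: "'a set set" and p1 p2 a p3 p4 b p5 p6 c z :: 'a
  assumes tree: "tree_graph V E"
    and distinct: "distinct [p1, p2, p3, p4, p5, p6, a, b, c, z]"
    and vertices: "V = {p1, p2, p3, p4, p5, p6, a, b, c, z}"
    and edges: "E = {{p1, a}, {p2, a}, {p3, b}, {p4, b}, {p5, c}, {p6, c}, {a, z}, {b, z}, {c, z}}"
    and leaves: "boundary V E = {p1, p2, p3, p4, p5, p6}"

lemma tripod_swap_leaves:
  assumes "tripod V E p1 p2 a p3 p4 b p5 p6 c z"
  shows "tripod V E p2 p1 a p3 p4 b p5 p6 c z"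
proof -
  interpret tripod V E p1 p2 a p3 p4 b p5 p6 c z by fact
  have "distinct [p2, p1, p3, p4, p5, p6, a, b, c, z]" using distinct by auto
  moreover have "V = {p2, p1, p3, p4, p5, p6, a, b, c, z}" unfolding vertices by (simp only: insert_commute)
  moreover have "E = {{p2, a}, {p1, a}, {p3, b}, {p4, b}, {p5, c}, {p6, c}, {a, z}, {b, z}, {c, z}}"
    unfolding edges by (simp only: insert_commute)
  moreover have "boundary V E = {p2, p1, p3, p4, p5, p6}" unfolding leaves by (simp only: insert_commute)
  ultimately show ?thesis using tree by unfold_locales
qed

lemma tripod_swap_arms:
  assumes "tripod V E p1 p2 a p3 p4 b p5 p6 c z"
  shows "tripod V E p3 p4 b p1 p2 a p5 p6 c z"
proof -
  interpret tripod V E p1 p2 a p3 p4 b p5 p6 c z by fact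
  have "distinct [p3, p4, p1, p2, p5, p6, b, a, c, z]" using distinct by auto
  moreover have "V = {p3, p4, p1, p2, p5, p6, b, a, c, z}" unfolding vertices by (simp only: insert_commute)
  moreover have "E = {{p3, b}, {p4, b}, {p1, a}, {p2, a}, {p5, c}, {p6, c}, {b, z}, {a, z}, {c, z}}"
    unfolding edges by (simp only: insert_commute)
  moreover have "boundary V E = {p3, p4, p1, p2, p5, p6}" unfolding leaves by (simp only: insert_commute)
  ultimately show ?thesis using tree by unfold_locales
qed

lemma tripod_rotate_arms:
  assumes "tripod V E p1 p2 a p3 p4 b p5 p6 c z"
  shows "tripod V E p3 p4 b p5 p6 c p1 p2 a z"
proof -
  interpret tripod V E p1 p2 a p3 p4 b p5 p6 c z by fact
  have "distinct [p3, p4, p5, p6, p1, p2, b, c, a, z]" using distinct by auto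
  moreover have "V = {p3, p4, p5, p6, p1, p2, b, c, a, z}" unfolding vertices by (simp only: insert_commute)
  moreover have "E = {{p3, b}, {p4, b}, {p5, c}, {p6, c}, {p1, a}, {p2, a}, {b, z}, {c, z}, {a, z}}"
    unfolding edges by (simp only: insert_commute)
  moreover have "boundary V E = {p3, p4, p5, p6, p1, p2}" unfolding leaves by (simp only: insert_commute)
  ultimately show ?thesis using tree by unfold_locales
qed

context tripod
begin

lemma distinct_reversed: "distinct [z, c, b, a, p6, p5, p4, p3, p2, p1]"
  using distinct_rev[THEN iffD2, OF distinct] by simp

lemma tree_path_moustache: "tree_path V E p1 p2 = {{p1, a}, {p2, a}}"
proof -
  have "path_joining V E p1 p2 [p1, a, p2]"
    using distinct distinct_reversed by (simp add: path_joining_def graph_path_successively vertices edges insert_commute)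
  from tree_path_eq[OF tree this] show ?thesis by (simp add: insert_commute)
qed

lemma tree_path_between_arms:
  assumes "x \<in> {p1, p2}" "y \<in> {p3, p4}"
  shows "tree_path V E x y = {{x, a}, {a, z}, {b, z}, {y, b}}"
proof -
  have "path_joining V E x y [x, a, z, b, y]"
    using assms distinct distinct_reversed
    by (auto simp: path_joining_def graph_path_successively vertices edges insert_commute)
  from tree_path_eq[OF tree this] show ?thesis by (simp add: insert_commute)
qed

lemma separated_by_leaf_edge:
  assumes "u \<in> boundary V E" "v \<in> boundary V E"
  shows "separated_by V E {p1, a} u v \<longleftrightarrow> (u = p1) \<noteq> (v = p1)"
proof -
  let ?F = "E - {{p1, a}}" and ?B = "{p2, p3, p4, p5, p6, a, b, c, z}"
  let ?R = "\<lambda>x y. {x, y} \<in> ?F"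
  have R: "?R z a" "?R z b" "?R z c" "?R a p2" "?R b p3" "?R b p4" "?R c p5" "?R c p6"
    using distinct distinct_reversed by (simp_all add: edges doubleton_eq_iff)
  have "components_of_graph V ?F = {{p1}, ?B}"
  proof (rule components_of_graph_two)
    show "simple_graph V ?F" using tree unfolding tree_graph_def simple_graph_def by blast
    show "V = {p1} \<union> ?B" unfolding vertices by blast
    show "{p1} \<inter> ?B = {}" using distinct distinct_reversed by simp
    show "?R\<^sup>*\<^sup>* z x" if "x \<in> ?B" for x
      using that r_into_rtranclp[of ?R, OF R(1)] r_into_rtranclp[of ?R, OF R(2)] r_into_rtranclp[of ?R, OF R(3)]
        rtranclp_two[of ?R, OF R(1) R(4)] rtranclp_two[of ?R, OF R(2) R(5)]
        rtranclp_two[of ?R, OF R(2) R(6)] rtranclp_two[of ?R, OF R(3) R(7)]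
        rtranclp_two[of ?R, OF R(3) R(8)]
      by (elim insertE; simp)
    show "e \<subseteq> {p1} \<or> e \<subseteq> ?B" if "e \<in> ?F" for e
      using that unfolding edges by auto
  qed auto
  moreover have "{p1} \<inter> ?B = {}" using distinct by simp
  moreover have "boundary V E \<subseteq> {p1} \<union> ?B"
    unfolding leaves by (simp only: insert_subset empty_subsetI insert_iff Un_iff simp_thms)
  ultimately have "separated_by V E {p1, a} u v \<longleftrightarrow> (u \<in> {p1}) \<noteq> (v \<in> {p1})"
    using assms by (intro separated_by_two) (auto simp only:)
  then show ?thesis by simp
qed

lemma separated_by_inner_edge:
  assumes "u \<in> boundary V E" "v \<in> boundary V E"
  shows "separated_by V E {a, z} u v \<longleftrightarrow> (u \<in> {p1, p2}) \<noteq> (v \<in> {p1, p2})"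
proof -
  let ?F = "E - {{a, z}}" and ?A = "{p1, p2, a}" and ?B = "{p3, p4, p5, p6, b, c, z}"
  let ?R = "\<lambda>x y. {x, y} \<in> ?F"
  have R: "?R a p1" "?R a p2" "?R z b" "?R z c" "?R b p3" "?R b p4" "?R c p5" "?R c p6"
    using distinct distinct_reversed by (simp_all add: edges doubleton_eq_iff)
  have "components_of_graph V ?F = {?A, ?B}"
  proof (rule components_of_graph_two)
    show "simple_graph V ?F" using tree unfolding tree_graph_def simple_graph_def by blast
    show "V = ?A \<union> ?B" unfolding vertices by blast
    show "?A \<inter> ?B = {}" using distinct distinct_reversed by simp
    show "?R\<^sup>*\<^sup>* a x" if "x \<in> ?A" for x
      using that r_into_rtranclp[of ?R, OF R(1)] r_into_rtranclp[of ?R, OF R(2)]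
      by (elim insertE; simp)
    show "?R\<^sup>*\<^sup>* z x" if "x \<in> ?B" for x
      using that r_into_rtranclp[of ?R, OF R(3)] r_into_rtranclp[of ?R, OF R(4)]
        rtranclp_two[of ?R, OF R(3) R(5)] rtranclp_two[of ?R, OF R(3) R(6)]
        rtranclp_two[of ?R, OF R(4) R(7)] rtranclp_two[of ?R, OF R(4) R(8)]
      by (elim insertE; simp)
    show "e \<subseteq> ?A \<or> e \<subseteq> ?B" if "e \<in> ?F" for e
      using that unfolding edges by auto
  qed auto
  moreover have "?A \<inter> ?B = {}" using distinct by simp
  moreover have "boundary V E \<subseteq> ?A \<union> ?B"
    unfolding leaves by (simp only: insert_subset empty_subsetI insert_iff Un_iff simp_thms)
  ultimately have "separated_by V E {a, z} u v \<longleftrightarrow> (u \<in> ?A) \<noteq> (v \<in> ?A)"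
    using assms by (intro separated_by_two) (auto simp only:)
  then show ?thesis using assms distinct unfolding leaves by auto
qed

end

lemma boundary_unique_edge:
  assumes "simple_graph V E" "v \<in> boundary V E" "e \<in> E" "v \<in> e" "f \<in> E" "v \<in> f"
  shows "e = f"
proof -
  have "card {e \<in> E. v \<in> e} \<le> Suc 0"
    using assms(2) by (simp add: boundary_def vertex_degree_def)
  then show ?thesis
    using finite_edges[OF assms(1)] assms(3-) by (auto simp: card_le_Suc0_iff_eq)
qed

lemma moustaches_common_neighbour:
  assumes "{u, v} \<in> moustaches V E"
  obtains w where "{u, w} \<in> E" "{v, w} \<in> E" "u \<noteq> v"
  using assms unfolding moustaches_def by (auto simp: doubleton_eq_iff)

lemma moustache_hub:
  assumes T: "binary_tree V E" and "u \<noteq> v" "{u, w} \<in> E" "{v, w} \<in> E"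
  shows "w \<in> V" "w \<notin> boundary V E" "vertex_degree E w = 3"
proof -
  have G: "simple_graph V E" using T by (simp add: binary_tree_def tree_graph_def)
  show w: "w \<in> V" using simple_graph_edgeD[OF G assms(3)] by simp
  show nb: "w \<notin> boundary V E"
    using boundary_unique_edge[OF G _ assms(3) _ assms(4)] \<open>u \<noteq> v\<close> by (auto simp: doubleton_eq_iff)
  show "vertex_degree E w = 3"
    using T w nb by (auto simp: binary_tree_def boundary_def)
qed

text \<open>A common hub of two moustaches would have degree at least 4.\<close>

lemma moustache_hubs_distinct:
  assumes T: "binary_tree V E" and d: "distinct [p1, p2, p3, p4]"
    and e: "{p1, w} \<in> E" "{p2, w} \<in> E" "{p3, w} \<in> E" "{p4, w} \<in> E"
  shows False
proof -
  have G: "simple_graph V E" using T by (simp add: binary_tree_def tree_graph_def)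
  have "{{p1, w}, {p2, w}, {p3, w}, {p4, w}} \<subseteq> {e \<in> E. w \<in> e}" using e by simp
  from card_mono[OF _ this] have "card {{p1, w}, {p2, w}, {p3, w}, {p4, w}} \<le> vertex_degree E w"
    by (simp add: vertex_degree_def finite_edges[OF G])
  moreover have "vertex_degree E w = 3" using moustache_hub[OF T _ e(1,2)] d by simp
  moreover have "card {{p1, w}, {p2, w}, {p3, w}, {p4, w}} = 4"
    using d by (auto simp: card_insert_if doubleton_eq_iff)
  ultimately show False by simp
qed

text \<open>With \<open>k\<close> inner vertices, the degrees give \<open>2|E| = 3k + 6\<close>, so \<open>k\<close> is even, and \<open>|E| < |V| = k + 6\<close> gives
\<open>k \<le> 4\<close>; with \<open>k \<ge> 3\<close> only \<open>k = 4\<close> is left.\<close>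

lemma binary_tree_six_leaves:
  assumes T: "binary_tree V E" and "card (boundary V E) = 6" and ge: "3 \<le> card (V - boundary V E)"
  shows "card (V - boundary V E) = 4" "card E = 9"
proof -
  let ?B = "boundary V E"
  have G: "simple_graph V E" and ne: "V \<noteq> {}" and acyc: "\<nexists>xs. graph_cycle V E xs"
    using T by (simp_all add: binary_tree_def tree_graph_def)
  have fin: "finite V" and sub: "?B \<subseteq> V"
    using G by (auto simp: simple_graph_def boundary_def)
  have "2 * card E = (\<Sum>v\<in>V. vertex_degree E v)" by (rule handshake[OF G, symmetric])
  also have "\<dots> = (\<Sum>v\<in>V - ?B. vertex_degree E v) + (\<Sum>v\<in>?B. vertex_degree E v)"
    by (rule sum.subset_diff[OF sub fin])
  also have "(\<Sum>v\<in>V - ?B. vertex_degree E v) = (\<Sum>v\<in>V - ?B. 3)"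
    using T by (intro sum.cong) (auto simp: binary_tree_def boundary_def)
  also have "(\<Sum>v\<in>?B. vertex_degree E v) = (\<Sum>v\<in>?B. 1)"
    by (intro sum.cong) (auto simp: boundary_def)
  finally have hs: "2 * card E = 3 * card (V - ?B) + 6" using assms(2) by simp
  have "card V = card (V - ?B) + 6"
    using card_Diff_subset[OF finite_subset[OF sub fin] sub] card_mono[OF fin sub] assms(2) by simp
  with forest_card_edges[OF G ne acyc] hs ge
  show "card (V - boundary V E) = 4" "card E = 9" by presburger+
qed

text \<open>The three hubs are distinct inner vertices, so there is exactly one more, \<open>z\<close>. It has degree 3, and
the leaves are adjacent to hubs only, so its neighbours are the hubs. That exhausts the nine edges.\<close>

theorem three_moustaches_tripod:
  assumes T: "binary_tree V E" and bd: "boundary V E = {p1, p2, p3, p4, p5, p6}"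
    and d: "distinct [p1, p2, p3, p4, p5, p6]"
    and m: "{p1, p2} \<in> moustaches V E" "{p3, p4} \<in> moustaches V E" "{p5, p6} \<in> moustaches V E"
  obtains a b c z where "tripod V E p1 p2 a p3 p4 b p5 p6 c z"
proof -
  have G: "simple_graph V E" using T by (simp add: binary_tree_def tree_graph_def)
  have fin: "finite V" using G by (simp add: simple_graph_def)
  obtain a where a: "{p1, a} \<in> E" "{p2, a} \<in> E" "p1 \<noteq> p2" by (rule moustaches_common_neighbour[OF m(1)])
  obtain b where b: "{p3, b} \<in> E" "{p4, b} \<in> E" "p3 \<noteq> p4" by (rule moustaches_common_neighbour[OF m(2)])
  obtain c where c: "{p5, c} \<in> E" "{p6, c} \<in> E" "p5 \<noteq> p6" by (rule moustaches_common_neighbour[OF m(3)])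
  note hubs = moustache_hub[OF T a(3,1,2)] moustache_hub[OF T b(3,1,2)] moustache_hub[OF T c(3,1,2)]
  have "a \<noteq> b" using moustache_hubs_distinct[OF T _ a(1,2), of p3 p4] b d by auto
  moreover have "a \<noteq> c" using moustache_hubs_distinct[OF T _ a(1,2), of p5 p6] c d by auto
  moreover have "b \<noteq> c" using moustache_hubs_distinct[OF T _ b(1,2), of p5 p6] c d by auto
  ultimately have abc: "card {a, b, c} = 3" by simp
  let ?I = "V - boundary V E"
  have sub: "{a, b, c} \<subseteq> ?I" using hubs by simp
  have "card (boundary V E) = 6" using d unfolding bd by simp
  note count = binary_tree_six_leaves[OF T this]
  have "3 \<le> card ?I" using card_mono[OF _ sub] abc fin by simp
  note count = count[OF this]
  have "card (?I - {a, b, c}) = 1"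
    using card_Diff_subset[OF _ sub] abc count(1) by simp
  then obtain z where z: "?I - {a, b, c} = {z}" by (meson card_1_singletonE)
  then have zI: "z \<in> V" "z \<notin> boundary V E" "z \<notin> {a, b, c}" by blast+
  have I: "?I = {a, b, c, z}" using z sub by blast
  have bdV: "boundary V E \<subseteq> V" by (auto simp: boundary_def)
  have V: "V = {p1, p2, p3, p4, p5, p6, a, b, c, z}"
  proof -
    have "V = boundary V E \<union> ?I" using bdV by blast
    also have "\<dots> = {p1, p2, p3, p4, p5, p6} \<union> {a, b, c, z}" unfolding I unfolding bd ..
    finally show ?thesis by (simp only: Un_insert_left Un_empty_left)
  qed
  have dist: "distinct [p1, p2, p3, p4, p5, p6, a, b, c, z]"
    using d hubs zI \<open>a \<noteq> b\<close> \<open>a \<noteq> c\<close> \<open>b \<noteq> c\<close> unfolding bd by auto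
  have leaf_nbr: "y \<in> {a, b, c}" if "x \<in> boundary V E" "{x, y} \<in> E" for x y
  proof -
    have "\<exists>w\<in>{a, b, c}. {x, w} \<in> E" using that(1) a b c unfolding bd by auto
    then obtain w where "w \<in> {a, b, c}" "{x, w} \<in> E" by blast
    moreover have "{x, w} = {x, y}"
      using boundary_unique_edge[OF G that(1) \<open>{x, w} \<in> E\<close> _ that(2)] by simp
    ultimately show ?thesis by (auto simp: doubleton_eq_iff)
  qed
  have star: "{e \<in> E. z \<in> e} \<subseteq> {{a, z}, {b, z}, {c, z}}"
  proof
    fix e assume "e \<in> {e \<in> E. z \<in> e}"
    then have "e \<in> E" "z \<in> e" by simp_all
    from edge_at_vertex[OF G this] obtain w where w: "e = {z, w}" "w \<in> V" "w \<noteq> z" .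
    have "w \<notin> boundary V E"
      using leaf_nbr[of w z] \<open>e \<in> E\<close> zI(3) w(1) by (auto simp: insert_commute)
    with w(2,3) I have "w \<in> {a, b, c}" by blast
    then show "e \<in> {{a, z}, {b, z}, {c, z}}" unfolding w(1) by (auto simp: insert_commute)
  qed
  have "vertex_degree E z = 3"
    using T zI by (auto simp: binary_tree_def boundary_def)
  then have "card {{a, z}, {b, z}, {c, z}} \<le> card {e \<in> E. z \<in> e}"
    by (simp add: vertex_degree_def card_insert_if)
  then have "{e \<in> E. z \<in> e} = {{a, z}, {b, z}, {c, z}}"
    by (intro card_seteq star) simp_all
  then have z_edges: "{a, z} \<in> E" "{b, z} \<in> E" "{c, z} \<in> E" by blast+
  let ?E = "{{p1, a}, {p2, a}, {p3, b}, {p4, b}, {p5, c}, {p6, c}, {a, z}, {b, z}, {c, z}}"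
  have "?E \<subseteq> E" using a b c z_edges by simp
  moreover have "card ?E = 9"
    using dist dist[THEN distinct_rev[THEN iffD2]] by (simp add: card_insert_if doubleton_eq_iff)
  ultimately have "?E = E" using count(2) finite_edges[OF G] by (intro card_seteq) simp_all
  then have "tripod V E p1 p2 a p3 p4 b p5 p6 c z"
    using T bd V dist by unfold_locales (simp_all only: binary_tree_def)
  then show ?thesis by (rule that)
qed

section \<open>Its polyhedral set\<close>

lemma (in tripod) ball_edges:
  "(\<forall>e\<in>E. P e) \<longleftrightarrow> P {p1, a} \<and> P {p2, a} \<and> P {p3, b} \<and> P {p4, b} \<and> P {p5, c} \<and> P {p6, c} \<and>
    P {a, z} \<and> P {b, z} \<and> P {c, z}"
  unfolding edges by simp

text \<open>An edge equation involves the pairs of leaves on different sides of the edge. Adding the equations of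
the two leaf edges of a moustache and subtracting the one of its inner edge isolates twice its
coordinate.\<close>

lemma Lambda_tripod:
  assumes "tripod V E (p 1) (p 2) a (p 3) (p 4) b (p 5) (p 6) c z"
  shows "Lambda V E p 6 = tripod_polytope"
proof -
  note A = assms
  note B = tripod_rotate_arms[OF A]
  note C = tripod_rotate_arms[OF B]
  interpret tripod V E "p 1" "p 2" a "p 3" "p 4" b "p 5" "p 6" c z by fact
  have bd: "p 1 \<in> boundary V E" "p 2 \<in> boundary V E" "p 3 \<in> boundary V E" "p 4 \<in> boundary V E"
    "p 5 \<in> boundary V E" "p 6 \<in> boundary V E" unfolding leaves by simp_all
  note leaf = A[THEN tripod.separated_by_leaf_edge] A[THEN tripod_swap_leaves, THEN tripod.separated_by_leaf_edge]
    B[THEN tripod.separated_by_leaf_edge] B[THEN tripod_swap_leaves, THEN tripod.separated_by_leaf_edge]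
    C[THEN tripod.separated_by_leaf_edge] C[THEN tripod_swap_leaves, THEN tripod.separated_by_leaf_edge]
  note inner = A[THEN tripod.separated_by_inner_edge] B[THEN tripod.separated_by_inner_edge]
    C[THEN tripod.separated_by_inner_edge]
  have neq: "p i \<noteq> p j" if "i \<in> {1, 2, 3, 4, 5, 6}" "j \<in> {1, 2, 3, 4, 5, 6}" "i \<noteq> j" for i j
    using that distinct distinct_reversed by (elim insertE; simp)
  have pos: "(\<forall>i j. 1 \<le> i \<and> i < j \<and> j \<le> 6 \<longrightarrow> 0 \<le> pair_coord 6 x i j) \<longleftrightarrow> (\<forall>k. 0 \<le> x $ k)"
    for x :: "real^15"
    unfolding all_pairs_upto_6 pair_coord_def lex_pos_6 forall_15 by simp
  have eqs: "(\<forall>e\<in>E. (\<Sum>(i, j) \<in> {(i, j). 1 \<le> i \<and> i < j \<and> j \<le> 6 \<and> separated_by V E e (p i) (p j)}.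
      pair_coord 6 x i j) = 1) \<longleftrightarrow>
    x $ 1 + x $ 2 + x $ 3 + x $ 4 + x $ 5 = 1 \<and>
    x $ 1 + x $ 6 + x $ 7 + x $ 8 + x $ 9 = 1 \<and>
    x $ 2 + x $ 6 + x $ 10 + x $ 11 + x $ 12 = 1 \<and>
    x $ 3 + x $ 7 + x $ 10 + x $ 13 + x $ 14 = 1 \<and>
    x $ 4 + x $ 8 + x $ 11 + x $ 13 + x $ 15 = 1 \<and>
    x $ 5 + x $ 9 + x $ 12 + x $ 14 + x $ 15 = 1 \<and>
    x $ 2 + x $ 3 + x $ 4 + x $ 5 + x $ 6 + x $ 7 + x $ 8 + x $ 9 = 1 \<and>
    x $ 2 + x $ 3 + x $ 6 + x $ 7 + x $ 11 + x $ 12 + x $ 13 + x $ 14 = 1 \<and>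
    x $ 4 + x $ 5 + x $ 8 + x $ 9 + x $ 11 + x $ 12 + x $ 13 + x $ 14 = 1" for x :: "real^15"
    unfolding ball_edges sum_pairs_upto_6
    by (simp add: leaf inner bd neq pair_coord_def lex_pos_6 add.assoc del: One_nat_def split del: if_split)
  show ?thesis
  proof (intro set_eqI)
    fix x :: "real^15"
    show "x \<in> Lambda V E p 6 \<longleftrightarrow> x \<in> tripod_polytope"
      unfolding Lambda_def tripod_polytope_def mem_Collect_eq pos eqs
      by (intro conj_cong[OF refl] iffI conjI; linarith)
  qed
qed

section \<open>Generalized fillings\<close>

context tripod
begin

lemma sum_edges:
  fixes f :: "'a set \<Rightarrow> real"
  shows "sum f E = f {p1, a} + f {p2, a} + f {p3, b} + f {p4, b} + f {p5, c} + f {p6, c} +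
    f {a, z} + f {b, z} + f {c, z}"
  unfolding edges using distinct distinct_reversed by (simp add: doubleton_eq_iff add.assoc)

lemma path_weight_moustache:
  fixes f :: "'a set \<Rightarrow> real"
  shows "sum f (tree_path V E p1 p2) = f {p1, a} + f {p2, a}"
  unfolding tree_path_moustache using distinct by (simp add: doubleton_eq_iff)

lemma path_weight_between_arms:
  fixes f :: "'a set \<Rightarrow> real"
  assumes "x \<in> {p1, p2}" "y \<in> {p3, p4}"
  shows "sum f (tree_path V E x y) = f {x, a} + f {a, z} + f {b, z} + f {y, b}"
  unfolding tree_path_between_arms[OF assms]
  using assms distinct distinct_reversed by (auto simp: doubleton_eq_iff)

end

lemma generalized_filling_tripod:
  assumes "tripod V E (p 1) (p 2) a (p 3) (p 4) b (p 5) (p 6) c z"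
  shows "generalized_filling V E p 6 \<rho> \<omega> \<longleftrightarrow>
    \<rho> (p 1) (p 2) \<le> \<omega> {p 1, a} + \<omega> {p 2, a} \<and>
    \<rho> (p 1) (p 3) \<le> \<omega> {p 1, a} + \<omega> {a, z} + \<omega> {b, z} + \<omega> {p 3, b} \<and>
    \<rho> (p 1) (p 4) \<le> \<omega> {p 1, a} + \<omega> {a, z} + \<omega> {b, z} + \<omega> {p 4, b} \<and>
    \<rho> (p 1) (p 5) \<le> \<omega> {p 1, a} + \<omega> {a, z} + \<omega> {c, z} + \<omega> {p 5, c} \<and>
    \<rho> (p 1) (p 6) \<le> \<omega> {p 1, a} + \<omega> {a, z} + \<omega> {c, z} + \<omega> {p 6, c} \<and>
    \<rho> (p 2) (p 3) \<le> \<omega> {p 2, a} + \<omega> {a, z} + \<omega> {b, z} + \<omega> {p 3, b} \<and>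
    \<rho> (p 2) (p 4) \<le> \<omega> {p 2, a} + \<omega> {a, z} + \<omega> {b, z} + \<omega> {p 4, b} \<and>
    \<rho> (p 2) (p 5) \<le> \<omega> {p 2, a} + \<omega> {a, z} + \<omega> {c, z} + \<omega> {p 5, c} \<and>
    \<rho> (p 2) (p 6) \<le> \<omega> {p 2, a} + \<omega> {a, z} + \<omega> {c, z} + \<omega> {p 6, c} \<and>
    \<rho> (p 3) (p 4) \<le> \<omega> {p 3, b} + \<omega> {p 4, b} \<and>
    \<rho> (p 3) (p 5) \<le> \<omega> {p 3, b} + \<omega> {b, z} + \<omega> {c, z} + \<omega> {p 5, c} \<and>
    \<rho> (p 3) (p 6) \<le> \<omega> {p 3, b} + \<omega> {b, z} + \<omega> {c, z} + \<omega> {p 6, c} \<and>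
    \<rho> (p 4) (p 5) \<le> \<omega> {p 4, b} + \<omega> {b, z} + \<omega> {c, z} + \<omega> {p 5, c} \<and>
    \<rho> (p 4) (p 6) \<le> \<omega> {p 4, b} + \<omega> {b, z} + \<omega> {c, z} + \<omega> {p 6, c} \<and>
    \<rho> (p 5) (p 6) \<le> \<omega> {p 5, c} + \<omega> {p 6, c}"
proof -
  note A = assms
  note B = tripod_rotate_arms[OF A]
  note C = tripod_rotate_arms[OF B]
  note short = A[THEN tripod.path_weight_moustache] B[THEN tripod.path_weight_moustache]
    C[THEN tripod.path_weight_moustache]
  note long = A[THEN tripod.path_weight_between_arms] B[THEN tripod.path_weight_between_arms]
    C[THEN tripod_swap_arms, THEN tripod.path_weight_between_arms]
  show ?thesis
    unfolding generalized_filling_def all_pairs_upto_6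
    by (simp add: short long del: One_nat_def)
qed

text \<open>Strong duality. Given the leaf values \<open>u\<close>, an inner edge at a moustache takes weight \<open>A\<close> and its leaf edges
\<open>u\<^sub>i - A\<close>: paths between arms then weigh \<open>u\<^sub>i + u\<^sub>j\<close> whatever \<open>A\<close> is, while the total weight decreases in \<open>A\<close>,
so \<open>A\<close> is taken as large as the path inside the moustache allows.\<close>

lemma mpf_minus_tripod:
  fixes d :: "real^15"
  assumes T: "tripod V E (p 1) (p 2) a (p 3) (p 4) b (p 5) (p 6) c z"
    and d: "d = vector [\<rho> (p 1) (p 2), \<rho> (p 1) (p 3), \<rho> (p 1) (p 4), \<rho> (p 1) (p 5), \<rho> (p 1) (p 6),
    \<rho> (p 2) (p 3), \<rho> (p 2) (p 4), \<rho> (p 2) (p 5), \<rho> (p 2) (p 6), \<rho> (p 3) (p 4), \<rho> (p 3) (p 5),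
    \<rho> (p 3) (p 6), \<rho> (p 4) (p 5), \<rho> (p 4) (p 6), \<rho> (p 5) (p 6)]"
  shows "mpf_minus V E p 6 \<rho> = ereal (Max ((\<bullet>) d ` tripod_vertices))"
proof -
  interpret tripod V E "p 1" "p 2" a "p 3" "p 4" b "p 5" "p 6" c z by fact
  note filling = generalized_filling_tripod[OF T, of \<rho>]
  define m where "m = Max ((\<bullet>) d ` tripod_vertices)"
  have m: "d \<bullet> v \<le> m" if "v \<in> tripod_vertices" for v
    unfolding m_def using that finite_tripod_vertices by simp
  note d_nth = vector_15[OF d]
  have lower: "d \<bullet> x \<le> sum \<omega> E" if x: "x \<in> tripod_polytope" and \<omega>: "generalized_filling V E p 6 \<rho> \<omega>" for x \<omega>
  proof -
    from x have pos: "0 \<le> x $ k" for k by (simp add: tripod_polytope_def)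
    define w1 w2 w3 w4 w5 w6 A B C where "w1 = \<omega> {p 1, a}" and "w2 = \<omega> {p 2, a}" and "w3 = \<omega> {p 3, b}"
      and "w4 = \<omega> {p 4, b}" and "w5 = \<omega> {p 5, c}" and "w6 = \<omega> {p 6, c}" and "A = \<omega> {a, z}"
      and "B = \<omega> {b, z}" and "C = \<omega> {c, z}"
    note w = \<omega>[unfolded filling, folded w1_def w2_def w3_def w4_def w5_def w6_def A_def B_def C_def d_nth]
    have "d \<bullet> x \<le> (w1 + w2) * x $ 1 + (w1 + A + B + w3) * x $ 2 + (w1 + A + B + w4) * x $ 3 +
        (w1 + A + C + w5) * x $ 4 + (w1 + A + C + w6) * x $ 5 + (w2 + A + B + w3) * x $ 6 +
        (w2 + A + B + w4) * x $ 7 + (w2 + A + C + w5) * x $ 8 + (w2 + A + C + w6) * x $ 9 +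
        (w3 + w4) * x $ 10 + (w3 + B + C + w5) * x $ 11 + (w3 + B + C + w6) * x $ 12 +
        (w4 + B + C + w5) * x $ 13 + (w4 + B + C + w6) * x $ 14 + (w5 + w6) * x $ 15"
      unfolding inner_15 by (intro add_mono mult_right_mono pos) (use w in blast)+
    also have "\<dots> = w1 * (x $ 1 + (x $ 2 + x $ 3 + x $ 4 + x $ 5)) + w2 * (x $ 1 + (x $ 6 + x $ 7 + x $ 8 + x $ 9))
      + w3 * (x $ 10 + (x $ 2 + x $ 6 + x $ 11 + x $ 12)) + w4 * (x $ 10 + (x $ 3 + x $ 7 + x $ 13 + x $ 14))
      + w5 * (x $ 15 + (x $ 4 + x $ 8 + x $ 11 + x $ 13)) + w6 * (x $ 15 + (x $ 5 + x $ 9 + x $ 12 + x $ 14))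
      + A * ((x $ 2 + x $ 3 + x $ 4 + x $ 5) + (x $ 6 + x $ 7 + x $ 8 + x $ 9))
      + B * ((x $ 2 + x $ 6 + x $ 11 + x $ 12) + (x $ 3 + x $ 7 + x $ 13 + x $ 14))
      + C * ((x $ 4 + x $ 8 + x $ 11 + x $ 13) + (x $ 5 + x $ 9 + x $ 12 + x $ 14))"
      by (simp only: distrib_left distrib_right ac_simps)
    also have "\<dots> = w1 + w2 + w3 + w4 + w5 + w6 + A + B + C"
    proof -
      from x have e: "x $ 1 = 1/2" "x $ 10 = 1/2" "x $ 15 = 1/2"
        "x $ 2 + x $ 3 + x $ 4 + x $ 5 = 1/2" "x $ 6 + x $ 7 + x $ 8 + x $ 9 = 1/2"
        "x $ 2 + x $ 6 + x $ 11 + x $ 12 = 1/2" "x $ 3 + x $ 7 + x $ 13 + x $ 14 = 1/2"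
        "x $ 4 + x $ 8 + x $ 11 + x $ 13 = 1/2" "x $ 5 + x $ 9 + x $ 12 + x $ 14 = 1/2"
        unfolding tripod_polytope_def by blast+
      show ?thesis unfolding e by simp
    qed
    also have "\<dots> = sum \<omega> E"
      unfolding sum_edges w1_def w2_def w3_def w4_def w5_def w6_def A_def B_def C_def by simp
    finally show ?thesis .
  qed
  obtain u1 u2 u3 u4 u5 u6 where u:
    "d $ 2 \<le> u1 + u3" "d $ 3 \<le> u1 + u4" "d $ 4 \<le> u1 + u5" "d $ 5 \<le> u1 + u6"
    "d $ 6 \<le> u2 + u3" "d $ 7 \<le> u2 + u4" "d $ 8 \<le> u2 + u5" "d $ 9 \<le> u2 + u6"
    "d $ 11 \<le> u3 + u5" "d $ 12 \<le> u3 + u6" "d $ 13 \<le> u4 + u5" "d $ 14 \<le> u4 + u6"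
    "u1 + u2 + u3 + u4 + u5 + u6 + d $ 1 + d $ 10 + d $ 15 = 2 * m"
    by (rule dual_solution[of d m, OF m])
  define A B C where "A = (u1 + u2 - d $ 1) / 2" and "B = (u3 + u4 - d $ 10) / 2"
    and "C = (u5 + u6 - d $ 15) / 2"
  \<comment> \<open>Weights on vertices that produce the edge weights as sums over the two ends.\<close>
  define h where "h = (\<lambda>_. 0)(p 1 := u1 - 2 * A, p 2 := u2 - 2 * A, p 3 := u3 - 2 * B, p 4 := u4 - 2 * B,
    p 5 := u5 - 2 * C, p 6 := u6 - 2 * C, a := A, b := B, c := C)"
  define \<omega> where "\<omega> e = sum h e" for e
  have \<omega>: "\<omega> {p 1, a} = u1 - A" "\<omega> {p 2, a} = u2 - A" "\<omega> {p 3, b} = u3 - B" "\<omega> {p 4, b} = u4 - B"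
    "\<omega> {p 5, c} = u5 - C" "\<omega> {p 6, c} = u6 - C" "\<omega> {a, z} = A" "\<omega> {b, z} = B" "\<omega> {c, z} = C"
    using distinct distinct_reversed by (simp_all add: \<omega>_def h_def)
  have fill: "generalized_filling V E p 6 \<rho> \<omega>"
    unfolding filling \<omega> d_nth[symmetric] using u by (simp add: A_def B_def C_def field_simps)
  have total: "sum \<omega> E = m"
    unfolding sum_edges \<omega> using u(13) by (simp add: A_def B_def C_def field_simps)
  have "tripod_vertices \<noteq> {}" by (simp add: tripod_vertices_def)
  then have "m \<in> (\<bullet>) d ` tripod_vertices" unfolding m_def using finite_tripod_vertices by (intro Max_in) auto
  then obtain v where v: "v \<in> tripod_vertices" "m = d \<bullet> v" by blast
  have "mpf_minus V E p 6 \<rho> = ereal m"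
    unfolding mpf_minus_def
  proof (rule antisym)
    show "(INF \<omega>\<in>{\<omega>. generalized_filling V E p 6 \<rho> \<omega>}. ereal (sum \<omega> E)) \<le> ereal m"
      using fill total by (intro INF_lower2[of \<omega>]) auto
    show "ereal m \<le> (INF \<omega>\<in>{\<omega>. generalized_filling V E p 6 \<rho> \<omega>}. ereal (sum \<omega> E))"
      using lower v tripod_vertices_subset by (intro INF_greatest) auto
  qed
  then show ?thesis by (simp add: m_def)
qed

section \<open>The six-point theorem\<close>

theorem mainTheorem5:
  fixes V M :: "'a set" and E :: "'a set set"
    and \<rho> :: "'a \<Rightarrow> 'a \<Rightarrow> real" and p :: "nat \<Rightarrow> 'a"
  assumes "Metric_space M \<rho>"
    and "bij_betw p {1..6} M"
    and "binary_tree V E"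
    and "boundary V E = M"
    and "moustaches V E = {{p 1, p 2}, {p 3, p 4}, {p 5, p 6}}"
  shows
    "(let \<Lambda> = Lambda V E p 6 :: (real ^ 15) set;
          vertices =
            {(1/2) *\<^sub>R vector [1, 0, 0, 0, 1, 0, 1, 0, 0, 1, 1, 0, 0, 0, 1],
             (1/2) *\<^sub>R vector [1, 0, 1, 0, 0, 0, 0, 0, 1, 1, 1, 0, 0, 0, 1],
             (1/2) *\<^sub>R vector [1, 0, 0, 1, 0, 0, 1, 0, 0, 1, 0, 1, 0, 0, 1],
             (1/2) *\<^sub>R vector [1, 0, 1, 0, 0, 0, 0, 1, 0, 1, 0, 1, 0, 0, 1],
             (1/4) *\<^sub>R vector [2, 1, 0, 0, 1, 0, 1, 1, 0, 2, 0, 1, 1, 0, 2],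
             (1/4) *\<^sub>R vector [2, 0, 1, 1, 0, 1, 0, 0, 1, 2, 0, 1, 1, 0, 2],
             (1/2) *\<^sub>R vector [1, 0, 0, 0, 1, 1, 0, 0, 0, 1, 0, 0, 1, 0, 1],
             (1/2) *\<^sub>R vector [1, 1, 0, 0, 0, 0, 0, 0, 1, 1, 0, 0, 1, 0, 1],
             (1/4) *\<^sub>R vector [2, 0, 1, 0, 1, 1, 0, 1, 0, 2, 1, 0, 0, 1, 2],
             (1/4) *\<^sub>R vector [2, 1, 0, 1, 0, 0, 1, 0, 1, 2, 1, 0, 0, 1, 2],
             (1/2) *\<^sub>R vector [1, 0, 0, 1, 0, 1, 0, 0, 0, 1, 0, 0, 0, 1, 1],
             (1/2) *\<^sub>R vector [1, 1, 0, 0, 0, 0, 0, 1, 0, 1, 0, 0, 0, 1, 1]};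
          d = (\<lambda>i j. \<rho> (p i) (p j))
      in polyhedron \<Lambda> \<and> bounded \<Lambda> \<and> aff_dim \<Lambda> = 6 \<and>
         {x. x extreme_point_of \<Lambda>} = vertices \<and> card vertices = 12 \<and>
         mpf_minus V E p 6 \<rho> = ereal (Max
            {(d 1 2 + d 1 6 + d 2 4 + d 3 4 + d 3 5 + d 5 6) / 2,
             (d 1 2 + d 1 4 + d 2 6 + d 3 4 + d 3 5 + d 5 6) / 2,
             (d 1 2 + d 1 5 + d 2 4 + d 3 4 + d 3 6 + d 5 6) / 2,
             (d 1 2 + d 1 4 + d 2 5 + d 3 4 + d 3 6 + d 5 6) / 2,
             (2 * d 1 2 + d 1 3 + d 1 6 + d 2 4 + d 2 5 + 2 * d 3 4 + d 3 6 + d 4 5 + 2 * d 5 6) / 4,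
             (2 * d 1 2 + d 1 4 + d 1 5 + d 2 3 + d 2 6 + 2 * d 3 4 + d 3 6 + d 4 5 + 2 * d 5 6) / 4,
             (d 1 2 + d 1 6 + d 2 3 + d 3 4 + d 4 5 + d 5 6) / 2,
             (d 1 2 + d 1 3 + d 2 6 + d 3 4 + d 4 5 + d 5 6) / 2,
             (2 * d 1 2 + d 1 4 + d 1 6 + d 2 3 + d 2 5 + 2 * d 3 4 + d 3 5 + d 4 6 + 2 * d 5 6) / 4,
             (2 * d 1 2 + d 1 3 + d 1 5 + d 2 4 + d 2 6 + 2 * d 3 4 + d 3 5 + d 4 6 + 2 * d 5 6) / 4,
             (d 1 2 + d 1 5 + d 2 3 + d 3 4 + d 4 6 + d 5 6) / 2,
             (d 1 2 + d 1 3 + d 2 5 + d 3 4 + d 4 6 + d 5 6) / 2}))"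
proof -
  let ?d = "vector [\<rho> (p 1) (p 2), \<rho> (p 1) (p 3), \<rho> (p 1) (p 4), \<rho> (p 1) (p 5), \<rho> (p 1) (p 6),
    \<rho> (p 2) (p 3), \<rho> (p 2) (p 4), \<rho> (p 2) (p 5), \<rho> (p 2) (p 6), \<rho> (p 3) (p 4), \<rho> (p 3) (p 5),
    \<rho> (p 3) (p 6), \<rho> (p 4) (p 5), \<rho> (p 4) (p 6), \<rho> (p 5) (p 6)] :: real^15"
  have six: "{1..6::nat} = {1, 2, 3, 4, 5, 6}" by auto
  have inj: "inj_on p {1, 2, 3, 4, 5, 6}" and image: "p ` {1, 2, 3, 4, 5, 6} = M"
    using assms(2) unfolding bij_betw_def six by blast+
  have bd: "boundary V E = {p 1, p 2, p 3, p 4, p 5, p 6}"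
    unfolding assms(4) image[symmetric] by simp
  have "distinct (map p [1, 2, 3, 4, 5, 6])"
    unfolding distinct_map using inj by simp
  then have dist: "distinct [p 1, p 2, p 3, p 4, p 5, p 6]" by (simp only: list.map)
  have "{p 1, p 2} \<in> moustaches V E" "{p 3, p 4} \<in> moustaches V E" "{p 5, p 6} \<in> moustaches V E"
    unfolding assms(5) by simp_all
  then obtain a b c z where T: "tripod V E (p 1) (p 2) a (p 3) (p 4) b (p 5) (p 6) c z"
    by (rule three_moustaches_tripod[OF assms(3) bd dist])
  have "polytope tripod_polytope"
    unfolding tripod_polytope_eq_hull by (rule polytope_convex_hull[OF finite_tripod_vertices])
  then have poly: "polyhedron tripod_polytope" "bounded tripod_polytope"
    by (simp_all add: polytope_imp_polyhedron polytope_imp_bounded)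
  have attained: "(\<bullet>) ?d ` tripod_vertices = (let d = (\<lambda>i j. \<rho> (p i) (p j)) in
            {(d 1 2 + d 1 6 + d 2 4 + d 3 4 + d 3 5 + d 5 6) / 2,
             (d 1 2 + d 1 4 + d 2 6 + d 3 4 + d 3 5 + d 5 6) / 2,
             (d 1 2 + d 1 5 + d 2 4 + d 3 4 + d 3 6 + d 5 6) / 2,
             (d 1 2 + d 1 4 + d 2 5 + d 3 4 + d 3 6 + d 5 6) / 2,
             (2 * d 1 2 + d 1 3 + d 1 6 + d 2 4 + d 2 5 + 2 * d 3 4 + d 3 6 + d 4 5 + 2 * d 5 6) / 4,
             (2 * d 1 2 + d 1 4 + d 1 5 + d 2 3 + d 2 6 + 2 * d 3 4 + d 3 6 + d 4 5 + 2 * d 5 6) / 4,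
             (d 1 2 + d 1 6 + d 2 3 + d 3 4 + d 4 5 + d 5 6) / 2,
             (d 1 2 + d 1 3 + d 2 6 + d 3 4 + d 4 5 + d 5 6) / 2,
             (2 * d 1 2 + d 1 4 + d 1 6 + d 2 3 + d 2 5 + 2 * d 3 4 + d 3 5 + d 4 6 + 2 * d 5 6) / 4,
             (2 * d 1 2 + d 1 3 + d 1 5 + d 2 4 + d 2 6 + 2 * d 3 4 + d 3 5 + d 4 6 + 2 * d 5 6) / 4,
             (d 1 2 + d 1 5 + d 2 3 + d 3 4 + d 4 6 + d 5 6) / 2,
             (d 1 2 + d 1 3 + d 2 5 + d 3 4 + d 4 6 + d 5 6) / 2})"
    unfolding tripod_vertices_def image_insert image_empty Let_def inner_15
    by (intro arg_cong2[of _ _ _ _ insert] refl) (simp_all add: add_divide_distrib)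
  show ?thesis
    unfolding Let_def Lambda_tripod[OF T] tripod_vertices_def[symmetric]
    by (intro conjI poly aff_dim_tripod_polytope extreme_points_tripod_polytope card_tripod_vertices
        mpf_minus_tripod[OF T refl, of \<rho>, unfolded attained Let_def])
qed

end
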